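(* Let $(\Omega,\mathcal A,(p_\theta\cdot\mu)_{\theta\in\Theta})$, $\Theta\subseteq\mathbb R$, be a statistical model with monotone likelihood ratio with respect to the statistic $T$. Let $\{\Theta_1,\Theta_0\}$ be pure two-sided hypotheses based on the one-sided hypotheses $\{\Theta'_1,\Theta'_0\}$ and $\{\Theta''_1,\Theta''_0\}$, $\Theta'_1\subset\Theta''_1$. Put $B=T^{-1}(\mathbb R-D_i^{\Theta''_0}-D_s^{\Theta'_1})$. Suppose that either $B$ is negligible, or $B$ is not negligible and there exist $\theta_a\in\Theta'_1$, $\theta_b\in\Theta_0$ and $\theta_c\in\Theta''_0$ for which there is no almost sure covering $B_a\cup B_c\supseteq B$ of $B$ by two events such that the density ratio $p_{\theta_b}/p_{\theta_a}$ is constant on $B_a$ where it is defined and $p_{\theta_c}/p_{\theta_b}$ is constant on $B_c$ where it is defined. Then the set of experts of this decision problem (the choice between $\Theta_1$ and $\Theta_0$) reduces to the trivial experts, i.e. the experts are the decision rules almost surely equal to $\mathbf 1_{D_i^{\Theta_0}\cup D_s^{\Theta_0}}(T)$ or to $1-\mathbf 1_{D_i^{\Theta''_0}\cap D_s^{\Theta'_1}}(T)$.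
   Context: $P_\theta=p_\theta\cdot\mu$ with fixed densities. For $\Theta'\subseteq\Theta$, "$\Theta'$ a.s." means $P_\theta$-a.s. for every $\theta\in\Theta'$; "almost surely", "negligible" without qualification mean for all $\theta\in\Theta$; an almost sure covering means that $B-(B_a\cup B_c)$ is negligible. A ratio of densities is defined where numerator and denominator are not both zero. Monotone likelihood ratio: $T:\Omega\to\mathbb R$ is measurable and for all $\theta'<\theta''$ in $\Theta$ there is a nondecreasing $h_{(\theta'',\theta')}:\mathbb R\to[0,+\infty]$ with $p_{\theta''}/p_{\theta'}=h_{(\theta'',\theta')}(T)$ outside $\{p_{\theta'}=p_{\theta''}=0\}$. One-sided hypotheses $\{\Theta_1,\Theta_0\}$: partition of $\Theta$ into two nonempty sets, every element of $\Theta_1$ being smaller than every element of $\Theta_0$. For $\Theta'\subseteq\Theta$: $D_i^{\Theta'}$ (resp. $D_s^{\Theta'}$) is the largest lower (resp. upper) half-line of $\mathbb R$, open or closed, possibly empty, such that $p_\theta=0$ on $T^{-1}(D_i^{\Theta'})$ (resp. $T^{-1}(D_s^{\Theta'})$) for all $\theta\in\Theta'$. Two-sided hypotheses based on one-sided hypotheses $\{\Theta'_1,\Theta'_0\}$, $\{\Theta''_1,\Theta''_0\}$ with $\Theta'_1\subset\Theta''_1$ (strictly): $\Theta_1=\Theta'_1\cup\Theta''_0$, $\Theta_0=\Theta'_0-\Theta''_0=\Theta''_1-\Theta'_1$ (so $\Theta'_1,\Theta_0,\Theta''_0$ is an ordered partition of $\Theta$ into three nonempty sets). They are pure if for every $\theta_0\in\Theta_0$: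 $P_{\theta_0}(T^{-1}(\mathbb R-D_s^{\Theta'_1}))>0$ and $P_{\theta_0}(T^{-1}(\mathbb R-D_i^{\Theta''_0}))>0$. Decision rule: measurable $\phi:\Omega\to\{0,1\}$; $\phi=d$ means deciding $\theta\in\Theta_d$. For an event $C$ with $P_\theta(C)\ne0$, $E_\theta^C$ is expectation under $P_\theta(\cdot\mid C)$. Expert of the choice between two probabilities $P_{\theta_0}$ and $P_{\theta_1}$: a decision rule $\phi$ such that for every event $C$: $P_{\theta_1}(C\cap\{\phi=0\})=0$ if $P_{\theta_0}(C)=0$; $P_{\theta_0}(C\cap\{\phi=1\})=0$ if $P_{\theta_1}(C)=0$; $E_{\theta_1}^C(\phi)\ge E_{\theta_0}^C(\phi)$ if $P_{\theta_0}(C)\neq0$ and $P_{\theta_1}(C)\ne0$. Expert of the choice between $\Theta_0$ and $\Theta_1$: a decision rule $\phi$ such that (i) for every $(\theta_0,\theta_1)\in\Theta_0\times\Theta_1$, $\phi$ is an expert of the choice between $P_{\theta_0}$ and $P_{\theta_1}$, or else $E_{\theta_0}(\phi)=0$ or $E_{\theta_1}(\phi)=1$; (ii) for every event $A$ with $\mathbf 1_A=0$ $\Theta_0$ a.s. (resp. $\Theta_1$ a.s.) one has $\phi\mathbf 1_A=\mathbf 1_A$ $\Theta_1$ a.s. (resp. $\phi\mathbf 1_A=0$ $\Theta_0$ a.s.). *)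

theory Defs
  imports "HOL-Probability.Probability"
begin

definition distr_of :: "'a measure \<Rightarrow> (real \<Rightarrow> 'a \<Rightarrow> real) \<Rightarrow> real \<Rightarrow> 'a measure" where
  "distr_of M p \<theta> = density M (\<lambda>x. ennreal (p \<theta> x))"

definition statistical_model :: "'a measure \<Rightarrow> (real \<Rightarrow> 'a \<Rightarrow> real) \<Rightarrow> real set \<Rightarrow> bool" where
  "statistical_model M p \<Theta> \<longleftrightarrow>
     (\<forall>\<theta>\<in>\<Theta>. p \<theta> \<in> borel_measurable M \<and> (\<forall>x\<in>space M. 0 \<le> p \<theta> x) \<and>
        prob_space (distr_of M p \<theta>))"

definition almost_surely ::
  "'a measure \<Rightarrow> (real \<Rightarrow> 'a \<Rightarrow> real) \<Rightarrow> real set \<Rightarrow> ('a \<Rightarrow> bool) \<Rightarrow> bool" where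
  "almost_surely M p \<Theta>' Q \<longleftrightarrow> (\<forall>\<theta>\<in>\<Theta>'. AE x in distr_of M p \<theta>. Q x)"

definition negligible_event ::
  "'a measure \<Rightarrow> (real \<Rightarrow> 'a \<Rightarrow> real) \<Rightarrow> real set \<Rightarrow> 'a set \<Rightarrow> bool" where
  "negligible_event M p \<Theta> A \<longleftrightarrow> (\<forall>\<theta>\<in>\<Theta>. A \<in> null_sets (distr_of M p \<theta>))"

definition ratio_defined :: "(real \<Rightarrow> 'a \<Rightarrow> real) \<Rightarrow> real \<Rightarrow> real \<Rightarrow> 'a \<Rightarrow> bool" where
  "ratio_defined p s t x \<longleftrightarrow> \<not> (p s x = 0 \<and> p t x = 0)"

text \<open>Division in \<^typ>\<open>ennreal\<close> yields \<open>\<infinity>\<close> for a positive numerator and a zero denominator;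
  the value at \<open>0 / 0\<close> is never used, since \<open>ratio_defined\<close> guards every use.\<close>

definition density_ratio :: "(real \<Rightarrow> 'a \<Rightarrow> real) \<Rightarrow> real \<Rightarrow> real \<Rightarrow> 'a \<Rightarrow> ennreal" where
  "density_ratio p s t x = ennreal (p s x) / ennreal (p t x)"

definition ratio_constant_on ::
  "(real \<Rightarrow> 'a \<Rightarrow> real) \<Rightarrow> real \<Rightarrow> real \<Rightarrow> 'a set \<Rightarrow> bool" where
  "ratio_constant_on p s t S \<longleftrightarrow>
     (\<exists>k. \<forall>x\<in>S. ratio_defined p s t x \<longrightarrow> density_ratio p s t x = k)"

definition monotone_likelihood_ratio ::
  "'a measure \<Rightarrow> (real \<Rightarrow> 'a \<Rightarrow> real) \<Rightarrow> real set \<Rightarrow> ('a \<Rightarrow> real) \<Rightarrow> bool" where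
  "monotone_likelihood_ratio M p \<Theta> T \<longleftrightarrow>
     T \<in> borel_measurable M \<and>
     (\<forall>s\<in>\<Theta>. \<forall>t\<in>\<Theta>. s < t \<longrightarrow>
        (\<exists>h :: real \<Rightarrow> ennreal. mono h \<and>
           (\<forall>x\<in>space M. ratio_defined p t s x \<longrightarrow> density_ratio p t s x = h (T x))))"

definition one_sided_hypotheses :: "real set \<Rightarrow> real set \<Rightarrow> real set \<Rightarrow> bool" where
  "one_sided_hypotheses \<Theta> \<Theta>1 \<Theta>0 \<longleftrightarrow>
     \<Theta>1 \<union> \<Theta>0 = \<Theta> \<and> \<Theta>1 \<inter> \<Theta>0 = {} \<and> \<Theta>1 \<noteq> {} \<and> \<Theta>0 \<noteq> {} \<and> (\<forall>s\<in>\<Theta>1. \<forall>t\<in>\<Theta>0. s < t)"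

definition two_sided_hypotheses ::
  "real set \<Rightarrow> real set \<Rightarrow> real set \<Rightarrow> real set \<Rightarrow> real set \<Rightarrow> real set \<Rightarrow> real set \<Rightarrow> bool" where
  "two_sided_hypotheses \<Theta> \<Theta>1' \<Theta>0' \<Theta>1'' \<Theta>0'' \<Theta>1 \<Theta>0 \<longleftrightarrow>
     one_sided_hypotheses \<Theta> \<Theta>1' \<Theta>0' \<and> one_sided_hypotheses \<Theta> \<Theta>1'' \<Theta>0'' \<and>
     \<Theta>1' \<subset> \<Theta>1'' \<and> \<Theta>1 = \<Theta>1' \<union> \<Theta>0'' \<and> \<Theta>0 = \<Theta>0' - \<Theta>0''"

definition lower_half_line :: "real set \<Rightarrow> bool" where
  "lower_half_line D \<longleftrightarrow> D = {} \<or> (\<exists>a. D = {..<a} \<or> D = {..a})"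

definition upper_half_line :: "real set \<Rightarrow> bool" where
  "upper_half_line D \<longleftrightarrow> D = {} \<or> (\<exists>a. D = {a<..} \<or> D = {a..})"

definition densities_vanish ::
  "'a measure \<Rightarrow> (real \<Rightarrow> 'a \<Rightarrow> real) \<Rightarrow> ('a \<Rightarrow> real) \<Rightarrow> real set \<Rightarrow> real set \<Rightarrow> bool" where
  "densities_vanish M p T \<Theta>' D \<longleftrightarrow> (\<forall>\<theta>\<in>\<Theta>'. \<forall>x \<in> T -` D \<inter> space M. p \<theta> x = 0)"

text \<open>The greatest half-lines below exist whenever \<open>\<Theta>'\<close> contains a parameter whose density is not
  identically zero, see \<open>D_low_greatest\<close> and \<open>D_up_greatest\<close>.\<close>

definition D_low ::
  "'a measure \<Rightarrow> (real \<Rightarrow> 'a \<Rightarrow> real) \<Rightarrow> ('a \<Rightarrow> real) \<Rightarrow> real set \<Rightarrow> real set" where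
  "D_low M p T \<Theta>' = (GREATEST D. lower_half_line D \<and> densities_vanish M p T \<Theta>' D)"

definition D_up ::
  "'a measure \<Rightarrow> (real \<Rightarrow> 'a \<Rightarrow> real) \<Rightarrow> ('a \<Rightarrow> real) \<Rightarrow> real set \<Rightarrow> real set" where
  "D_up M p T \<Theta>' = (GREATEST D. upper_half_line D \<and> densities_vanish M p T \<Theta>' D)"

lemma down_closed_half_line:
  fixes D :: "real set"
  assumes dc: "\<And>s t. t \<in> D \<Longrightarrow> s \<le> t \<Longrightarrow> s \<in> D" and "D \<noteq> UNIV"
  shows "lower_half_line D"
proof (cases "D = {}")
  case False
  obtain u where u: "u \<notin> D" using assms(2) by blast
  have bd: "bdd_above D" using dc u by (meson bdd_above.I linorder_le_cases)
  have "{..<Sup D} \<subseteq> D" using dc less_cSup_iff[OF False bd] by (meson lessThan_iff less_imp_le subsetI)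
  moreover have "D \<subseteq> {..Sup D}" using cSup_upper[OF _ bd] by auto
  moreover have "{..Sup D} = insert (Sup D) {..<Sup D}" by auto
  ultimately have "D = {..<Sup D} \<or> D = {..Sup D}"
    by (metis insert_subset subset_antisym subset_insert)
  then show ?thesis unfolding lower_half_line_def by blast
qed (simp add: lower_half_line_def)

lemma up_closed_half_line:
  fixes D :: "real set"
  assumes uc: "\<And>s t. t \<in> D \<Longrightarrow> t \<le> s \<Longrightarrow> s \<in> D" and "D \<noteq> UNIV"
  shows "upper_half_line D"
proof (cases "D = {}")
  case False
  obtain u where u: "u \<notin> D" using assms(2) by blast
  have bd: "bdd_below D" using uc u by (meson bdd_below.I linorder_le_cases)
  have "{Inf D<..} \<subseteq> D" using uc cInf_less_iff[OF False bd] by (meson greaterThan_iff less_imp_le subsetI)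
  moreover have "D \<subseteq> {Inf D..}" using cInf_lower[OF _ bd] by auto
  moreover have "{Inf D..} = insert (Inf D) {Inf D<..}" by auto
  ultimately have "D = {Inf D<..} \<or> D = {Inf D..}"
    by (metis insert_subset subset_antisym subset_insert)
  then show ?thesis unfolding upper_half_line_def by blast
qed (simp add: upper_half_line_def)

lemma D_low_greatest:
  assumes "\<theta> \<in> \<Theta>'" "x \<in> space M" "p \<theta> x \<noteq> 0"
  shows "lower_half_line (D_low M p T \<Theta>')"
    and "densities_vanish M p T \<Theta>' (D_low M p T \<Theta>')"
    and "lower_half_line D \<Longrightarrow> densities_vanish M p T \<Theta>' D \<Longrightarrow> D \<subseteq> D_low M p T \<Theta>'"
proof -
  define U where "U = \<Union> {D. lower_half_line D \<and> densities_vanish M p T \<Theta>' D}"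
  have v: "densities_vanish M p T \<Theta>' U" unfolding U_def densities_vanish_def by blast
  have "T x \<notin> U" using v assms unfolding densities_vanish_def by blast
  moreover have "s \<in> U" if t: "t \<in> U" and le: "s \<le> t" for s t
  proof -
    obtain D where D: "t \<in> D" "lower_half_line D" "densities_vanish M p T \<Theta>' D"
      using t unfolding U_def by blast
    have "s \<in> D" using D(1,2) le unfolding lower_half_line_def by auto
    with D show ?thesis unfolding U_def by blast
  qed
  ultimately have l: "lower_half_line U" by (metis UNIV_I down_closed_half_line)
  have g: "D \<subseteq> U" if "lower_half_line D" "densities_vanish M p T \<Theta>' D" for D
    using that unfolding U_def by blast
  have eq: "D_low M p T \<Theta>' = U" unfolding D_low_def
    by (rule Greatest_equality) (simp_all only: l v g simp_thms)
  show "lower_half_line (D_low M p T \<Theta>')" by (simp only: eq l)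
  show "densities_vanish M p T \<Theta>' (D_low M p T \<Theta>')" by (simp only: eq v)
  show "lower_half_line D \<Longrightarrow> densities_vanish M p T \<Theta>' D \<Longrightarrow> D \<subseteq> D_low M p T \<Theta>'"
    unfolding eq by (rule g)
qed

lemma D_up_greatest:
  assumes "\<theta> \<in> \<Theta>'" "x \<in> space M" "p \<theta> x \<noteq> 0"
  shows "upper_half_line (D_up M p T \<Theta>')"
    and "densities_vanish M p T \<Theta>' (D_up M p T \<Theta>')"
    and "upper_half_line D \<Longrightarrow> densities_vanish M p T \<Theta>' D \<Longrightarrow> D \<subseteq> D_up M p T \<Theta>'"
proof -
  define U where "U = \<Union> {D. upper_half_line D \<and> densities_vanish M p T \<Theta>' D}"
  have v: "densities_vanish M p T \<Theta>' U" unfolding U_def densities_vanish_def by blast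
  have "T x \<notin> U" using v assms unfolding densities_vanish_def by blast
  moreover have "s \<in> U" if t: "t \<in> U" and le: "t \<le> s" for s t
  proof -
    obtain D where D: "t \<in> D" "upper_half_line D" "densities_vanish M p T \<Theta>' D"
      using t unfolding U_def by blast
    have "s \<in> D" using D(1,2) le unfolding upper_half_line_def by auto
    with D show ?thesis unfolding U_def by blast
  qed
  ultimately have l: "upper_half_line U" by (metis UNIV_I up_closed_half_line)
  have g: "D \<subseteq> U" if "upper_half_line D" "densities_vanish M p T \<Theta>' D" for D
    using that unfolding U_def by blast
  have eq: "D_up M p T \<Theta>' = U" unfolding D_up_def
    by (rule Greatest_equality) (simp_all only: l v g simp_thms)
  show "upper_half_line (D_up M p T \<Theta>')" by (simp only: eq l)
  show "densities_vanish M p T \<Theta>' (D_up M p T \<Theta>')" by (simp only: eq v)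
  show "upper_half_line D \<Longrightarrow> densities_vanish M p T \<Theta>' D \<Longrightarrow> D \<subseteq> D_up M p T \<Theta>'"
    unfolding eq by (rule g)
qed

definition pure_two_sided ::
  "'a measure \<Rightarrow> (real \<Rightarrow> 'a \<Rightarrow> real) \<Rightarrow> ('a \<Rightarrow> real) \<Rightarrow> real set \<Rightarrow> real set \<Rightarrow> real set \<Rightarrow> bool" where
  "pure_two_sided M p T \<Theta>1' \<Theta>0'' \<Theta>0 \<longleftrightarrow>
     (\<forall>\<theta>\<in>\<Theta>0.
        measure (distr_of M p \<theta>) (T -` (UNIV - D_up M p T \<Theta>1') \<inter> space M) > 0 \<and>
        measure (distr_of M p \<theta>) (T -` (UNIV - D_low M p T \<Theta>0'') \<inter> space M) > 0)"

definition decision_rule :: "'a measure \<Rightarrow> ('a \<Rightarrow> real) \<Rightarrow> bool" where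
  "decision_rule M \<phi> \<longleftrightarrow> \<phi> \<in> borel_measurable M \<and> (\<forall>x\<in>space M. \<phi> x \<in> {0, 1})"

text \<open>\<^term>\<open>uniform_measure P C\<close> is the conditional probability of \<open>P\<close> given \<open>C\<close>.\<close>

definition cond_expectation :: "'a measure \<Rightarrow> 'a set \<Rightarrow> ('a \<Rightarrow> real) \<Rightarrow> real" where
  "cond_expectation P C \<phi> = (\<integral>x. \<phi> x \<partial>uniform_measure P C)"

definition expert_between_two ::
  "'a measure \<Rightarrow> 'a measure \<Rightarrow> 'a measure \<Rightarrow> ('a \<Rightarrow> real) \<Rightarrow> bool" where
  "expert_between_two M P0 P1 \<phi> \<longleftrightarrow>
     decision_rule M \<phi> \<and>
     (\<forall>C\<in>sets M.
        (measure P0 C = 0 \<longrightarrow> measure P1 (C \<inter> {x \<in> space M. \<phi> x = 0}) = 0) \<and>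
        (measure P1 C = 0 \<longrightarrow> measure P0 (C \<inter> {x \<in> space M. \<phi> x = 1}) = 0) \<and>
        (measure P0 C \<noteq> 0 \<and> measure P1 C \<noteq> 0 \<longrightarrow>
           cond_expectation P1 C \<phi> \<ge> cond_expectation P0 C \<phi>))"

definition expert ::
  "'a measure \<Rightarrow> (real \<Rightarrow> 'a \<Rightarrow> real) \<Rightarrow> real set \<Rightarrow> real set \<Rightarrow> ('a \<Rightarrow> real) \<Rightarrow> bool" where
  "expert M p \<Theta>0 \<Theta>1 \<phi> \<longleftrightarrow>
     decision_rule M \<phi> \<and>
     (\<forall>\<theta>0\<in>\<Theta>0. \<forall>\<theta>1\<in>\<Theta>1.
        expert_between_two M (distr_of M p \<theta>0) (distr_of M p \<theta>1) \<phi> \<or>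
        (\<integral>x. \<phi> x \<partial>distr_of M p \<theta>0) = 0 \<or> (\<integral>x. \<phi> x \<partial>distr_of M p \<theta>1) = 1) \<and>
     (\<forall>A\<in>sets M.
        (almost_surely M p \<Theta>0 (\<lambda>x. indicat_real A x = 0) \<longrightarrow>
           almost_surely M p \<Theta>1 (\<lambda>x. \<phi> x * indicat_real A x = indicat_real A x)) \<and>
        (almost_surely M p \<Theta>1 (\<lambda>x. indicat_real A x = 0) \<longrightarrow>
           almost_surely M p \<Theta>0 (\<lambda>x. \<phi> x * indicat_real A x = 0)))"

end

theory Submission imports Defs begin

text \<open>
  Write \<open>U = {\<phi> = 1}\<close> and \<open>V = {\<phi> = 0}\<close>. Condition (i) on a pair \<open>(b, t)\<close> forces
  \<open>P\<^sub>b(U') P\<^sub>t(V') \<le> P\<^sub>t(U') P\<^sub>b(V')\<close> for all events \<open>U' \<subseteq> U\<close>, \<open>V' \<subseteq> V\<close>, so \<open>p\<^sub>t / p\<^sub>b\<close> has a threshold \<open>k\<close>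
  that separates \<open>U\<close> from \<open>V\<close>. Let \<open>a < b < c\<close> lie in the three blocks of parameters and let \<open>k\<close>, \<open>l\<close> be
  the thresholds of \<open>p\<^sub>a / p\<^sub>b\<close> and \<open>p\<^sub>c / p\<^sub>b\<close>. These ratios vary in opposite directions with \<open>T\<close>, so
  if both \<open>U\<close> and \<open>V\<close> have positive \<open>P\<^sub>b\<close>-mass, then almost everywhere \<open>p\<^sub>a = k p\<^sub>b\<close> or \<open>p\<^sub>c = l p\<^sub>b\<close>,
  which is a covering excluded by hypothesis. Hence \<open>\<phi>\<close> is \<open>P\<^sub>b\<close>-a.s. constant for one \<open>b\<close>, and purity spreads
  this: \<open>\<phi> = 0\<close> \<open>\<Theta>\<^sub>0\<close>-a.s. or \<open>\<phi> = 1\<close> \<open>\<Theta>\<^sub>1\<close>-a.s. If \<open>B\<close> is negligible, purity alone gives this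
  alternative. The values left open are then fixed by condition (ii), because an event that is null for
  every parameter of a block lying above (below) \<open>\<theta>\<close> is, \<open>P\<^sub>\<theta>\<close>-almost surely, contained in the half-line
  preimage on which that block of densities vanishes.
\<close>

section \<open>Common zero sets, coinitial sets and ratio thresholds\<close>

text \<open>For nonempty \<open>S \<subseteq> \<Theta>\<close> this is the preimage of
  \<open>D_low M p T S\<close>. As a subset of the sample space it has an upper counterpart obtained
  by putting \<open>- T\<close> for \<open>T\<close>.\<close>

definition vanish_below ::
  "'a measure \<Rightarrow> (real \<Rightarrow> 'a \<Rightarrow> real) \<Rightarrow> ('a \<Rightarrow> real) \<Rightarrow> real set \<Rightarrow> 'a set" where
  "vanish_below M p T S = {x \<in> space M. \<forall>\<theta>\<in>S. \<forall>y\<in>space M. T y \<le> T x \<longrightarrow> p \<theta> y = 0}"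

text \<open>The rationals of \<open>K\<close> and its minimum, if it has one, suffice: below a
  non-minimal \<open>t\<close> lies another element \<open>u\<close> of \<open>K\<close>, and a
  rational between them is in \<open>K\<close>. In \<open>AE_vanish_below\<close> this reduces
  uncountably many null sets to countably many.\<close>

lemma countable_coinitial_subset:
  fixes K :: "real set"
  assumes "\<And>s t. s \<in> K \<Longrightarrow> s \<le> t \<Longrightarrow> t \<in> K"
  obtains S where "countable S" "S \<subseteq> K" "\<And>t. t \<in> K \<Longrightarrow> \<exists>s\<in>S. s \<le> t"
proof
  define S where "S = (K \<inter> \<rat>) \<union> {m \<in> K. \<forall>t\<in>K. m \<le> t}"
  have "{m \<in> K. \<forall>t\<in>K. m \<le> t} \<subseteq> {Inf K}"
    by (auto intro!: cInf_eq_minimum[symmetric])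
  then have "countable {m \<in> K. \<forall>t\<in>K. m \<le> t}" by (rule countable_subset) simp
  then show "countable S" unfolding S_def by (simp add: countable_rat)
  show "S \<subseteq> K" unfolding S_def by auto
  show "\<exists>s\<in>S. s \<le> t" if "t \<in> K" for t
  proof (cases "\<forall>u\<in>K. t \<le> u")
    case True
    then show ?thesis using that unfolding S_def by auto
  next
    case False
    then obtain u where u: "u \<in> K" "u < t" by auto
    obtain r where "r \<in> \<rat>" "u < r" "r < t" using Rats_dense_in_real[OF u(2)] by auto
    then show ?thesis using assms[OF u(1), of r] unfolding S_def by (intro bexI[of _ r]) auto
  qed
qed

text \<open>For every real \<open>r\<close>, either \<open>r * f \<le> g\<close> a.e. on
  \<open>U\<close>, or \<open>g \<le> r * f\<close> a.e. on the part of \<open>V\<close> where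
  \<open>f\<close> is nonzero; otherwise the sets where the two bounds fail contradict
  \<open>dom\<close>. The threshold \<open>k\<close> is the supremum of the \<open>r\<close> of the
  first kind, and both bounds survive the passage to the limit.\<close>

lemma ratio_threshold:
  fixes f g :: "'a \<Rightarrow> real"
  assumes [measurable]: "f \<in> borel_measurable M" "g \<in> borel_measurable M" "U \<in> sets M" "V \<in> sets M"
    and int: "integrable M f" "integrable M g"
    and nn: "\<And>x. x \<in> space M \<Longrightarrow> 0 \<le> f x" "\<And>x. x \<in> space M \<Longrightarrow> 0 \<le> g x"
    and dom: "\<And>U' V'. U' \<in> sets M \<Longrightarrow> V' \<in> sets M \<Longrightarrow> U' \<subseteq> U \<Longrightarrow> V' \<subseteq> V \<Longrightarrow>
      (LINT x|M. indicator U' x * f x) * (LINT x|M. indicator V' x * g x)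
      \<le> (LINT x|M. indicator U' x * g x) * (LINT x|M. indicator V' x * f x)"
    and U: "\<not> (AE x in M. x \<in> U \<longrightarrow> f x = 0)"
  obtains k where "0 \<le> k" "AE x in M. x \<in> U \<longrightarrow> k * f x \<le> g x"
    "AE x in M. x \<in> V \<longrightarrow> f x \<noteq> 0 \<longrightarrow> g x \<le> k * f x"
proof -
  have int': "integrable M (\<lambda>x. indicator C x * f x)" "integrable M (\<lambda>x. indicator C x * g x)"
    if [measurable]: "C \<in> sets M" for C
    using integrable_mult_indicator[OF that int(1)] integrable_mult_indicator[OF that int(2)] by simp_all
  have alt: "(AE x in M. x \<in> U \<longrightarrow> r * f x \<le> g x) \<or>
             (AE x in M. x \<in> V \<longrightarrow> f x \<noteq> 0 \<longrightarrow> g x \<le> r * f x)" for r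
  proof (rule ccontr)
    assume neg: "\<not> ?thesis"
    \<comment> \<open>On \<open>U'\<close> the integral of \<open>g\<close> is below
      \<open>r\<close> times that of \<open>f\<close>; on \<open>V'\<close> it is at least
      \<open>r\<close> times that of \<open>f\<close>, which is positive. Multiplying these bounds
      reverses \<open>dom\<close>.\<close>
    define U' where "U' = {x \<in> space M. x \<in> U \<and> g x < r * f x}"
    define V' where "V' = {x \<in> space M. x \<in> V \<and> f x \<noteq> 0 \<and> r * f x < g x}"
    have m[measurable]: "U' \<in> sets M" "V' \<in> sets M" unfolding U'_def V'_def by measurable
    let ?I = "\<lambda>C h. LINT x|M. indicator C x * h x :: real"
    have "0 < (LINT x|M. indicator U' x * (r * f x - g x))"
    proof -
      have i: "integrable M (\<lambda>x. indicator U' x * (r * f x - g x))"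
        using integrable_mult_indicator[OF m(1), of "\<lambda>x. r * f x - g x"] int by simp
      have n: "AE x in M. 0 \<le> indicator U' x * (r * f x - g x)"
        by (auto simp: U'_def indicator_def)
      have "\<not> (AE x in M. indicator U' x * (r * f x - g x) = 0)"
      proof
        assume "AE x in M. indicator U' x * (r * f x - g x) = 0"
        then have "AE x in M. x \<in> U \<longrightarrow> r * f x \<le> g x"
          by (rule AE_mp) (auto simp: U'_def indicator_def intro!: AE_I2)
        then show False using neg by simp
      qed
      then show ?thesis
        using integral_nonneg_eq_0_iff_AE[OF i n] integral_nonneg_AE[OF n] by linarith
    qed
    also have "\<dots> = r * ?I U' f - ?I U' g"
      using int'[OF m(1)] by (simp add: algebra_simps)
    finally have 1: "?I U' g < r * ?I U' f" by simp
    have 2: "0 < ?I V' f"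
    proof -
      have n: "AE x in M. 0 \<le> indicator V' x * f x"
        using nn by (auto simp: V'_def indicator_def)
      have "\<not> (AE x in M. indicator V' x * f x = 0)"
      proof
        assume "AE x in M. indicator V' x * f x = 0"
        then have "AE x in M. x \<in> V \<longrightarrow> f x \<noteq> 0 \<longrightarrow> g x \<le> r * f x"
          by (rule AE_mp) (auto simp: V'_def indicator_def intro!: AE_I2)
        then show False using neg by simp
      qed
      then show ?thesis
        using integral_nonneg_eq_0_iff_AE[OF int'(1)[OF m(2)] n] integral_nonneg_AE[OF n] by linarith
    qed
    have 3: "r * ?I V' f \<le> ?I V' g"
    proof -
      have "(LINT x|M. r * (indicator V' x * f x)) \<le> ?I V' g"
        using int'[OF m(2)] by (intro integral_mono) (auto simp: V'_def indicator_def)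
      then show ?thesis using int'[OF m(2)] by simp
    qed
    have 4: "0 \<le> ?I U' f"
      using nn by (intro integral_nonneg_AE) (auto simp: U'_def indicator_def)
    have "?I U' g * ?I V' f < (r * ?I U' f) * ?I V' f" using 1 2 by simp
    also have "\<dots> = ?I U' f * (r * ?I V' f)" by simp
    also have "\<dots> \<le> ?I U' f * ?I V' g" using 3 4 by (rule mult_left_mono)
    also have "\<dots> \<le> ?I U' g * ?I V' f" by (rule dom[OF m]) (auto simp: U'_def V'_def)
    finally show False by simp
  qed
  define K where "K = {r. AE x in M. x \<in> U \<longrightarrow> r * f x \<le> g x}"
  have 0: "0 \<in> K" unfolding K_def using nn by (auto intro!: AE_I2)
  have down: "r \<in> K" if "s \<in> K" "r \<le> s" for r s
  proof -
    have "AE x in M. x \<in> U \<longrightarrow> s * f x \<le> g x" using that K_def by simp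
    then have "AE x in M. x \<in> U \<longrightarrow> r * f x \<le> g x"
      using AE_space
    proof eventually_elim
      case (elim x)
      then show ?case using mult_right_mono[OF that(2) nn(1)[of x]] by auto
    qed
    then show ?thesis unfolding K_def by simp
  qed
  \<comment> \<open>If all naturals were in \<open>K\<close>, the real number \<open>g x\<close>
    would bound every multiple of \<open>f x\<close> at almost every \<open>x\<close> of
    \<open>U\<close>, so \<open>f\<close> would vanish a.e. on \<open>U\<close>. Hence
    \<open>K\<close>, being downward closed, is bounded above.\<close>
  have "\<exists>n::nat. real n \<notin> K"
  proof (rule ccontr)
    assume "\<not> ?thesis"
    then have "AE x in M. \<forall>n::nat. x \<in> U \<longrightarrow> real n * f x \<le> g x"
      unfolding K_def AE_all_countable by simp
    then have "AE x in M. x \<in> U \<longrightarrow> f x = 0"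
      using AE_space
    proof eventually_elim
      case (elim x)
      show ?case
      proof (intro impI, rule ccontr)
        assume x: "x \<in> U" "f x \<noteq> 0"
        with nn(1) elim have "0 < f x" by (simp add: order_less_le)
        then obtain n :: nat where "g x < real n * f x" using reals_Archimedean3 by blast
        with elim x show False by (meson not_le)
      qed
    qed
    with U show False by simp
  qed
  then obtain n :: nat where n: "real n \<notin> K" by blast
  have bd: "bdd_above K" using down n by (meson bdd_above.I linorder_le_cases)
  define k where "k = Sup K"
  have lim: "(\<lambda>m. k - inverse (real (Suc m))) \<longlonglongrightarrow> k" "(\<lambda>m. k + inverse (real (Suc m))) \<longlonglongrightarrow> k"
    using tendsto_diff[OF tendsto_const LIMSEQ_inverse_real_of_nat, of k]
      tendsto_add[OF tendsto_const LIMSEQ_inverse_real_of_nat, of k] by simp_all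
  show ?thesis
  proof
    show "0 \<le> k" unfolding k_def using 0 bd by (rule cSup_upper)
    have "k - inverse (real (Suc m)) \<in> K" for m
    proof -
      have "k - inverse (real (Suc m)) < Sup K" unfolding k_def by simp
      then obtain r where "r \<in> K" "k - inverse (real (Suc m)) < r"
        using less_cSup_iff[of K] 0 bd by blast
      then show ?thesis using down by (meson less_imp_le)
    qed
    then have "AE x in M. \<forall>m. x \<in> U \<longrightarrow> (k - inverse (real (Suc m))) * f x \<le> g x"
      unfolding K_def AE_all_countable by simp
    then show "AE x in M. x \<in> U \<longrightarrow> k * f x \<le> g x"
    proof eventually_elim
      case (elim x)
      show ?case
        using elim by (intro impI LIMSEQ_le_const2[OF tendsto_mult_right[OF lim(1), of "f x"]]) auto
    qed
    \<comment> \<open>Above the supremum the first alternative fails, so \<open>alt\<close> supplies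
      the second.\<close>
    have "k + inverse (real (Suc m)) \<notin> K" for m
    proof
      assume "k + inverse (real (Suc m)) \<in> K"
      from cSup_upper[OF this bd] have "inverse (real (Suc m)) \<le> 0" by (simp add: k_def)
      moreover have "0 < inverse (real (Suc m))" by (intro positive_imp_inverse_positive of_nat_0_less_iff[THEN iffD2] zero_less_Suc)
      ultimately show False by linarith
    qed
    then have "AE x in M. \<forall>m. x \<in> V \<longrightarrow> f x \<noteq> 0 \<longrightarrow> g x \<le> (k + inverse (real (Suc m))) * f x"
      unfolding AE_all_countable using alt unfolding K_def by blast
    then show "AE x in M. x \<in> V \<longrightarrow> f x \<noteq> 0 \<longrightarrow> g x \<le> k * f x"
    proof eventually_elim
      case (elim x)
      show ?case
        using elim by (intro impI LIMSEQ_le_const[OF tendsto_mult_right[OF lim(2), of "f x"]]) auto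
    qed
  qed
qed

text \<open>Both products are compared with \<open>k * u * v\<close>, and one comparison is strict
  unless both bounds are equalities. In \<open>ratio_cover\<close> it makes a ratio differ strictly
  at two points unless it equals the threshold at both.\<close>

lemma cross_mult_strict:
  fixes k u v w z :: real
  assumes "0 < u" "0 < v" "k * u \<le> w" "z \<le> k * v" "\<not> (w = k * u \<and> z = k * v)"
  shows "z * u < w * v"
proof -
  have "z * u \<le> k * v * u" "k * u * v \<le> w * v"
    using assms by (simp_all add: mult_right_mono)
  moreover have "z * u < k * v * u \<or> k * u * v < w * v"
    using assms by auto
  ultimately show ?thesis by (auto simp: mult_ac)
qed

text \<open>The order of the parameters is an abstract relation, so that reversing it together with the sign of
  \<open>T\<close> gives another instance (lemma \<open>dual\<close>). The inequality \<open>cross\<close> is the monotone likelihood ratio property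
  with denominators cleared, which avoids the undefined and infinite ratios.\<close>

locale ordered_likelihood =
  fixes M :: "'a measure" and p :: "real \<Rightarrow> 'a \<Rightarrow> real" and \<Theta> :: "real set"
    and T :: "'a \<Rightarrow> real" and lt :: "real \<Rightarrow> real \<Rightarrow> bool"
  assumes p_measurable [measurable]: "\<theta> \<in> \<Theta> \<Longrightarrow> p \<theta> \<in> borel_measurable M"
    and p_nonneg: "\<theta> \<in> \<Theta> \<Longrightarrow> x \<in> space M \<Longrightarrow> 0 \<le> p \<theta> x"
    and prob: "\<theta> \<in> \<Theta> \<Longrightarrow> prob_space (distr_of M p \<theta>)"
    and T_measurable [measurable]: "T \<in> borel_measurable M"
    and cross: "s \<in> \<Theta> \<Longrightarrow> t \<in> \<Theta> \<Longrightarrow> lt s t \<Longrightarrow> x \<in> space M \<Longrightarrow> y \<in> space M \<Longrightarrow> T x \<le> T y \<Longrightarrow>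
      p t x * p s y \<le> p s x * p t y"
begin

section \<open>Order reversal and propagation of zeros\<close>

lemma dual: "ordered_likelihood M p \<Theta> (\<lambda>x. - T x) (\<lambda>s t. lt t s)"
proof (rule ordered_likelihood.intro)
  show "p t x * p s y \<le> p s x * p t y"
    if "s \<in> \<Theta>" "t \<in> \<Theta>" "lt t s" "x \<in> space M" "y \<in> space M" "- T x \<le> - T y" for s t x y
    using cross[of t s y x] that by (simp add: mult.commute)
qed (use p_nonneg prob in simp_all)

text \<open>The ratio \<open>p t / p s\<close> is 0 at \<open>x\<close> and does not decrease with
  \<open>T\<close>, so at \<open>y\<close> it is 0 or undefined, and \<open>p t y\<close> is 0
  either way.\<close>

lemma zero_below:
  assumes "s \<in> \<Theta>" "t \<in> \<Theta>" "lt s t" "x \<in> space M" "y \<in> space M" "T y \<le> T x" "p s x \<noteq> 0" "p t x = 0"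
  shows "p t y = 0"
  using cross[of s t y x] p_nonneg[of s x] p_nonneg[of t y] assms
  by (simp add: mult_le_0_iff)

text \<open>Here \<open>p t / p s\<close> is infinite at \<open>x\<close>, so at \<open>y\<close> it
  is infinite or undefined.\<close>

lemma zero_above:
  assumes "s \<in> \<Theta>" "t \<in> \<Theta>" "lt s t" "x \<in> space M" "y \<in> space M" "T x \<le> T y" "p t x \<noteq> 0" "p s x = 0"
  shows "p s y = 0"
  using cross[of s t x y] p_nonneg[of s y] p_nonneg[of t x] assms
  by (simp add: mult_le_0_iff)

section \<open>Almost sure statements expressed by densities\<close>

lemma sets_distr [simp, measurable_cong]: "sets (distr_of M p \<theta>) = sets M"
  and space_distr [simp]: "space (distr_of M p \<theta>) = space M"
  by (simp_all add: distr_of_def)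

lemma AE_distr:
  assumes "\<theta> \<in> \<Theta>"
  shows "(AE x in distr_of M p \<theta>. Q x) \<longleftrightarrow> (AE x in M. p \<theta> x \<noteq> 0 \<longrightarrow> Q x)"
proof -
  have "(AE x in distr_of M p \<theta>. Q x) \<longleftrightarrow> (AE x in M. 0 < ennreal (p \<theta> x) \<longrightarrow> Q x)"
    unfolding distr_of_def using assms by (intro AE_density) simp
  also have "\<dots> \<longleftrightarrow> (AE x in M. p \<theta> x \<noteq> 0 \<longrightarrow> Q x)"
    by (rule AE_cong) (use p_nonneg[OF assms] in \<open>auto simp: order_less_le\<close>)
  finally show ?thesis .
qed

lemma measure_distr_eq_0:
  assumes "\<theta> \<in> \<Theta>" "C \<in> sets M"
  shows "measure (distr_of M p \<theta>) C = 0 \<longleftrightarrow> (AE x in M. x \<in> C \<longrightarrow> p \<theta> x = 0)"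
proof -
  interpret prob_space "distr_of M p \<theta>" by (rule prob[OF assms(1)])
  have "measure (distr_of M p \<theta>) C = 0 \<longleftrightarrow> (AE x in distr_of M p \<theta>. x \<notin> C)"
    using assms(2) sets.sets_into_space[of C M]
    by (subst AE_iff_measurable[of C]) (auto simp: emeasure_eq_measure)
  then show ?thesis unfolding AE_distr[OF assms(1)]
    by (auto elim!: eventually_mono)
qed

lemma p_integrable: "\<theta> \<in> \<Theta> \<Longrightarrow> integrable M (p \<theta>)"
proof -
  assume \<theta>: "\<theta> \<in> \<Theta>"
  interpret prob_space "distr_of M p \<theta>" by (rule prob[OF \<theta>])
  have "integrable (distr_of M p \<theta>) (\<lambda>_. 1::real)" by simp
  then show ?thesis
    unfolding distr_of_def using \<theta> p_nonneg by (subst (asm) integrable_density) auto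
qed

lemma measure_distr:
  assumes "\<theta> \<in> \<Theta>" "C \<in> sets M"
  shows "measure (distr_of M p \<theta>) C = (LINT x|M. indicator C x * p \<theta> x)"
proof -
  interpret prob_space "distr_of M p \<theta>" by (rule prob[OF assms(1)])
  have "measure (distr_of M p \<theta>) C = (LINT x|distr_of M p \<theta>. indicator C x)"
    using assms(2) sets.sets_into_space[of C M] by (simp add: Int_absorb2)
  also have "\<dots> = (LINT x|M. indicator C x * p \<theta> x)"
    unfolding distr_of_def using assms p_nonneg by (subst integral_density) (auto simp: mult.commute)
  finally show ?thesis .
qed

lemma not_AE_zero: "\<theta> \<in> \<Theta> \<Longrightarrow> \<not> (AE x in M. p \<theta> x = 0)"
  using measure_distr_eq_0[of \<theta> "space M"] prob_space.prob_space[OF prob[of \<theta>]] by simp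

text \<open>Let \<open>K\<close> be the set of levels at or below which some \<open>p s\<close> is
  somewhere nonzero, say \<open>p s y \<noteq> 0\<close> with \<open>T y \<le> d\<close>. A point
  with \<open>p \<theta> x \<noteq> 0\<close>, \<open>Q x\<close> and \<open>d \<le> T x\<close> has
  a.e. \<open>p s x = 0\<close>, and then \<open>zero_below\<close> would give
  \<open>p s y = 0\<close>. Hence \<open>T x < d\<close> a.e., and countably many \<open>d\<close>
  exhaust \<open>K\<close>.\<close>

lemma AE_vanish_below:
  assumes S: "S \<subseteq> \<Theta>" and \<theta>: "\<theta> \<in> \<Theta>" "\<And>s. s \<in> S \<Longrightarrow> lt \<theta> s"
    and null: "\<And>s. s \<in> S \<Longrightarrow> AE x in M. p s x \<noteq> 0 \<longrightarrow> \<not> Q x"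
  shows "AE x in M. p \<theta> x \<noteq> 0 \<longrightarrow> Q x \<longrightarrow> x \<in> vanish_below M p T S"
proof -
  define K where "K = {t. \<exists>s\<in>S. \<exists>y\<in>space M. T y \<le> t \<and> p s y \<noteq> 0}"
  have up: "t \<in> K" if "s \<in> K" "s \<le> t" for s t
    using that order_trans[OF _ that(2)] unfolding K_def by blast
  obtain D
    where D: "countable D" "D \<subseteq> K" "\<And>t. t \<in> K \<Longrightarrow> \<exists>d\<in>D. d \<le> t"
    using countable_coinitial_subset[of K] up by blast
  have "AE x in M. p \<theta> x \<noteq> 0 \<longrightarrow> Q x \<longrightarrow> T x < d" if d: "d \<in> D" for d
  proof -
    obtain s y where s: "s \<in> S" "y \<in> space M" "T y \<le> d" "p s y \<noteq> 0"
      using d D(2) unfolding K_def by blast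
    from null[OF s(1)] AE_space show ?thesis
    proof eventually_elim
      case (elim x)
      then show ?case using zero_below[of \<theta> s x y] s S \<theta> by force
    qed
  qed
  then have "AE x in M. \<forall>d\<in>D. p \<theta> x \<noteq> 0 \<longrightarrow> Q x \<longrightarrow> T x < d"
    by (subst AE_ball_countable[OF D(1)]) blast
  with AE_space show ?thesis
  proof eventually_elim
    case (elim x)
    have "T x \<notin> K" if "p \<theta> x \<noteq> 0" "Q x" using D(3)[of "T x"] elim that by force
    then show ?case using elim unfolding K_def vanish_below_def by auto
  qed
qed

section \<open>Decision rules and expertise between two parameters\<close>

lemma decision_rule_cases:
  assumes "decision_rule M \<phi>"
  shows "\<phi> \<in> borel_measurable M" "x \<in> space M \<Longrightarrow> \<phi> x = 0 \<or> \<phi> x = 1"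
  using assms unfolding decision_rule_def by auto

lemma integral_decision_rule:
  assumes "decision_rule M \<phi>" "sets N = sets M"
  shows "(LINT x|N. \<phi> x) = measure N {x \<in> space M. \<phi> x = 1}"
proof -
  have [simp]: "space N = space M" using assms(2) by (rule sets_eq_imp_space_eq)
  have "(LINT x|N. \<phi> x) = (LINT x|N. indicator {x \<in> space M. \<phi> x = 1} x)"
    using decision_rule_cases(2)[OF assms(1)]
    by (intro Bochner_Integration.integral_cong) (auto simp: indicator_def)
  also have "\<dots> = measure N {x \<in> space M. \<phi> x = 1}"
    by (simp add: Int_absorb2 Collect_mono)
  finally show ?thesis .
qed

lemma integral_eq_0_iff:
  assumes \<phi>: "decision_rule M \<phi>" and \<theta>: "\<theta> \<in> \<Theta>"
  shows "(LINT x|distr_of M p \<theta>. \<phi> x) = 0 \<longleftrightarrow> (AE x in M. p \<theta> x \<noteq> 0 \<longrightarrow> \<phi> x = 0)"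
proof -
  note [measurable] = decision_rule_cases(1)[OF \<phi>]
  have "(AE x in M. x \<in> {x \<in> space M. \<phi> x = 1} \<longrightarrow> p \<theta> x = 0) \<longleftrightarrow>
        (AE x in M. p \<theta> x \<noteq> 0 \<longrightarrow> \<phi> x = 0)"
    by (rule AE_cong) (use decision_rule_cases(2)[OF \<phi>] in force)
  then show ?thesis
    using \<theta> by (simp add: integral_decision_rule[OF \<phi>] measure_distr_eq_0)
qed

lemma integral_eq_1_iff:
  assumes \<phi>: "decision_rule M \<phi>" and \<theta>: "\<theta> \<in> \<Theta>"
  shows "(LINT x|distr_of M p \<theta>. \<phi> x) = 1 \<longleftrightarrow> (AE x in M. p \<theta> x \<noteq> 0 \<longrightarrow> \<phi> x = 1)"
proof -
  interpret prob_space "distr_of M p \<theta>" by (rule prob[OF \<theta>])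
  note [measurable] = decision_rule_cases(1)[OF \<phi>]
  have "(LINT x|distr_of M p \<theta>. \<phi> x) = 1 \<longleftrightarrow> (AE x in distr_of M p \<theta>. x \<in> {x \<in> space M. \<phi> x = 1})"
    by (subst AE_in_set_eq_1) (simp_all add: integral_decision_rule[OF \<phi>])
  also have "\<dots> \<longleftrightarrow> (AE x in M. p \<theta> x \<noteq> 0 \<longrightarrow> \<phi> x = 1)"
    unfolding AE_distr[OF \<theta>] by (rule AE_cong) auto
  finally show ?thesis .
qed

lemma cond_expectation_decision_rule:
  assumes \<phi>: "decision_rule M \<phi>" and \<theta>: "\<theta> \<in> \<Theta>" and C: "C \<in> sets M" "measure (distr_of M p \<theta>) C \<noteq> 0"
  shows "cond_expectation (distr_of M p \<theta>) C \<phi> =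
    measure (distr_of M p \<theta>) (C \<inter> {x \<in> space M. \<phi> x = 1}) / measure (distr_of M p \<theta>) C"
proof -
  interpret prob_space "distr_of M p \<theta>" by (rule prob[OF \<theta>])
  note [measurable] = decision_rule_cases(1)[OF \<phi>]
  show ?thesis
    unfolding cond_expectation_def using C
    by (subst integral_decision_rule[OF \<phi>]) (auto simp: emeasure_eq_measure measure_uniform_measure)
qed

text \<open>Condition (i) for one pair, with the two degenerate expectations rewritten as statements
  almost everywhere in \<open>M\<close>.\<close>

definition separates :: "('a \<Rightarrow> real) \<Rightarrow> real \<Rightarrow> real \<Rightarrow> bool" where
  "separates \<phi> s t \<longleftrightarrow> decision_rule M \<phi> \<and>
     (expert_between_two M (distr_of M p s) (distr_of M p t) \<phi> \<or>
      (AE x in M. p s x \<noteq> 0 \<longrightarrow> \<phi> x = 0) \<or> (AE x in M. p t x \<noteq> 0 \<longrightarrow> \<phi> x = 1))"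

lemma expert_null:
  assumes ex: "expert_between_two M (distr_of M p s) (distr_of M p t) \<phi>" and st: "s \<in> \<Theta>" "t \<in> \<Theta>"
    and A: "A \<in> sets M"
  shows "AE x in M. x \<in> A \<longrightarrow> p s x = 0 \<Longrightarrow> AE x in M. x \<in> A \<longrightarrow> \<phi> x = 0 \<longrightarrow> p t x = 0"
    and "AE x in M. x \<in> A \<longrightarrow> p t x = 0 \<Longrightarrow> AE x in M. x \<in> A \<longrightarrow> \<phi> x = 1 \<longrightarrow> p s x = 0"
proof -
  have \<phi>: "decision_rule M \<phi>" using ex unfolding expert_between_two_def by simp
  note [measurable] = decision_rule_cases(1)[OF \<phi>] A
  { assume "AE x in M. x \<in> A \<longrightarrow> p s x = 0"
    then have "measure (distr_of M p t) (A \<inter> {x \<in> space M. \<phi> x = 0}) = 0"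
      using ex A st unfolding expert_between_two_def by (auto simp: measure_distr_eq_0[symmetric])
    then show "AE x in M. x \<in> A \<longrightarrow> \<phi> x = 0 \<longrightarrow> p t x = 0"
      using st AE_space by (subst (asm) measure_distr_eq_0) (auto elim: AE_mp) }
  { assume "AE x in M. x \<in> A \<longrightarrow> p t x = 0"
    then have "measure (distr_of M p s) (A \<inter> {x \<in> space M. \<phi> x = 1}) = 0"
      using ex A st unfolding expert_between_two_def by (auto simp: measure_distr_eq_0[symmetric])
    then show "AE x in M. x \<in> A \<longrightarrow> \<phi> x = 1 \<longrightarrow> p s x = 0"
      using st AE_space by (subst (asm) measure_distr_eq_0) (auto elim: AE_mp) }
qed

text \<open>Conditioning on \<open>U \<union> V\<close> turns expertise into a comparison of the
  shares of \<open>U\<close> in \<open>U \<union> V\<close> under the two probabilities; clearing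
  denominators gives the claim. In the degenerate alternatives the left side is 0.\<close>

lemma separates_dominates:
  assumes sep: "separates \<phi> s t" and st: "s \<in> \<Theta>" "t \<in> \<Theta>"
    and U: "U \<in> sets M" "\<And>x. x \<in> U \<Longrightarrow> \<phi> x = 1" and V: "V \<in> sets M" "\<And>x. x \<in> V \<Longrightarrow> \<phi> x = 0"
  shows "measure (distr_of M p s) U * measure (distr_of M p t) V
    \<le> measure (distr_of M p t) U * measure (distr_of M p s) V"
proof -
  let ?P = "distr_of M p s" and ?Q = "distr_of M p t"
  have \<phi>: "decision_rule M \<phi>" using sep unfolding separates_def by simp
  interpret P: prob_space ?P by (rule prob[OF st(1)])
  interpret Q: prob_space ?Q by (rule prob[OF st(2)])
  consider (expert) "expert_between_two M ?P ?Q \<phi>"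
    | (zero) "AE x in M. p s x \<noteq> 0 \<longrightarrow> \<phi> x = 0" | (one) "AE x in M. p t x \<noteq> 0 \<longrightarrow> \<phi> x = 1"
    using sep unfolding separates_def by blast
  then show ?thesis
  proof cases
    case zero
    then have "P.prob U = 0" using U st by (subst measure_distr_eq_0) (auto elim!: eventually_mono)
    then show ?thesis by simp
  next
    case one
    then have "Q.prob V = 0" using V st by (subst measure_distr_eq_0) (auto elim!: eventually_mono)
    then show ?thesis by simp
  next
    case expert
    define C where "C = U \<union> V"
    have C: "C \<in> sets M" using U V unfolding C_def by simp
    have disj: "U \<inter> V = {}" using U V by force
    have CU: "C \<inter> {x \<in> space M. \<phi> x = 1} = U"
      using U V sets.sets_into_space[OF U(1)] unfolding C_def by force
    have sum: "P.prob C = P.prob U + P.prob V" "Q.prob C = Q.prob U + Q.prob V"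
      unfolding C_def using U V disj by (auto intro!: P.finite_measure_Union Q.finite_measure_Union)
    show ?thesis
    proof (cases "P.prob C = 0 \<or> Q.prob C = 0")
      case True
      then have "P.prob U = 0 \<and> P.prob V = 0 \<or> Q.prob U = 0 \<and> Q.prob V = 0"
        using sum by (simp add: add_nonneg_eq_0_iff)
      then show ?thesis by auto
    next
      case False
      then have "cond_expectation ?P C \<phi> \<le> cond_expectation ?Q C \<phi>"
        using expert C unfolding expert_between_two_def by simp
      then have "P.prob U / P.prob C \<le> Q.prob U / Q.prob C"
        using False C st by (simp add: cond_expectation_decision_rule[OF \<phi>] CU)
      moreover have "0 < P.prob C" "0 < Q.prob C" using False by (simp_all add: zero_less_measure_iff)
      ultimately have "P.prob U * Q.prob C \<le> Q.prob U * P.prob C"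
        by (simp add: field_simps)
      then show ?thesis unfolding sum by (simp add: algebra_simps)
    qed
  qed
qed

text \<open>\<open>separates_dominates\<close> is the hypothesis \<open>dom\<close> of
  \<open>ratio_threshold\<close>; \<open>ne\<close> says that \<open>{\<phi> = 1}\<close> has
  positive mass for \<open>s\<close>, which keeps the threshold finite.\<close>

lemma separates_threshold:
  assumes sep: "separates \<phi> s t" and st: "s \<in> \<Theta>" "t \<in> \<Theta>"
    and ne: "\<not> (AE x in M. p s x \<noteq> 0 \<longrightarrow> \<phi> x = 0)"
  obtains k where "0 \<le> k" "AE x in M. \<phi> x = 1 \<longrightarrow> k * p s x \<le> p t x"
    "AE x in M. \<phi> x = 0 \<longrightarrow> p s x \<noteq> 0 \<longrightarrow> p t x \<le> k * p s x"
proof -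
  have \<phi>: "decision_rule M \<phi>" using sep unfolding separates_def by simp
  note [measurable] = decision_rule_cases(1)[OF \<phi>]
  let ?U = "{x \<in> space M. \<phi> x = 1}" and ?V = "{x \<in> space M. \<phi> x = 0}"
  have "\<not> (AE x in M. x \<in> ?U \<longrightarrow> p s x = 0)"
  proof
    assume "AE x in M. x \<in> ?U \<longrightarrow> p s x = 0"
    with AE_space have "AE x in M. p s x \<noteq> 0 \<longrightarrow> \<phi> x = 0"
      by eventually_elim (use decision_rule_cases(2)[OF \<phi>] in auto)
    with ne show False by simp
  qed
  moreover have "(LINT x|M. indicator U' x * p s x) * (LINT x|M. indicator V' x * p t x)
      \<le> (LINT x|M. indicator U' x * p t x) * (LINT x|M. indicator V' x * p s x)"
    if "U' \<in> sets M" "V' \<in> sets M" "U' \<subseteq> ?U" "V' \<subseteq> ?V" for U' V'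
    using separates_dominates[OF sep st, of U' V'] that st by (auto simp: measure_distr)
  ultimately obtain k where k: "0 \<le> k" "AE x in M. x \<in> ?U \<longrightarrow> k * p s x \<le> p t x"
    "AE x in M. x \<in> ?V \<longrightarrow> p s x \<noteq> 0 \<longrightarrow> p t x \<le> k * p s x"
    using ratio_threshold[of "p s" M "p t" ?U ?V] st p_integrable p_nonneg by auto
  show ?thesis
  proof
    show "0 \<le> k" by fact
    show "AE x in M. \<phi> x = 1 \<longrightarrow> k * p s x \<le> p t x"
      using k(2) AE_space by eventually_elim auto
    show "AE x in M. \<phi> x = 0 \<longrightarrow> p s x \<noteq> 0 \<longrightarrow> p t x \<le> k * p s x"
      using k(3) AE_space by eventually_elim auto
  qed
qed

section \<open>Behaviour of an expert on the middle block\<close>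

text \<open>Compare a point of \<open>{\<phi> = 1}\<close> with one of \<open>{\<phi> = 0}\<close>,
  both with \<open>p b > 0\<close>. Both ratios \<open>p a / p b\<close> and
  \<open>p c / p b\<close> are at least as large at the first point, but they vary oppositely with
  \<open>T\<close>, so one of them equals its threshold at both points.\<close>

lemma ratio_cover:
  assumes \<Theta>: "a \<in> \<Theta>" "b \<in> \<Theta>" "c \<in> \<Theta>" and lt: "lt a b" "lt b c"
    and sep: "separates \<phi> b a" "separates \<phi> b c"
    and n0: "\<not> (AE x in M. p b x \<noteq> 0 \<longrightarrow> \<phi> x = 0)" and n1: "\<not> (AE x in M. p b x \<noteq> 0 \<longrightarrow> \<phi> x = 1)"
  obtains Ba Bc where "Ba \<in> sets M" "Bc \<in> sets M"
    "ratio_constant_on p b a Ba" "ratio_constant_on p c b Bc" "AE x in M. x \<in> Ba \<union> Bc"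
proof -
  have \<phi>: "decision_rule M \<phi>" using sep unfolding separates_def by simp
  note [measurable] = decision_rule_cases(1)[OF \<phi>] p_measurable[OF \<Theta>(1)] p_measurable[OF \<Theta>(2)] p_measurable[OF \<Theta>(3)]
  obtain k where k: "0 \<le> k" "AE x in M. \<phi> x = 1 \<longrightarrow> k * p b x \<le> p a x"
    "AE x in M. \<phi> x = 0 \<longrightarrow> p b x \<noteq> 0 \<longrightarrow> p a x \<le> k * p b x"
    by (rule separates_threshold[OF sep(1) \<Theta>(2,1) n0])
  obtain l where l: "0 \<le> l" "AE x in M. \<phi> x = 1 \<longrightarrow> l * p b x \<le> p c x"
    "AE x in M. \<phi> x = 0 \<longrightarrow> p b x \<noteq> 0 \<longrightarrow> p c x \<le> l * p b x"
    by (rule separates_threshold[OF sep(2) \<Theta>(2,3) n0])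
  \<comment> \<open>Whichever of \<open>T x\<close> and \<open>T y\<close> is smaller,
    \<open>cross\<close> rules out one of the two strict inequalities.\<close>
  have mono: "\<not> (p a y * p b x < p a x * p b y \<and> p c y * p b x < p c x * p b y)"
    if "x \<in> space M" "y \<in> space M" for x y
    using cross[of a b y x] cross[of b c x y] \<Theta> lt that
    by (cases "T x \<le> T y") (auto simp: mult.commute)
  have mid: "p a x = k * p b x \<and> p a y = k * p b y \<or> p c x = l * p b x \<and> p c y = l * p b y"
    if xy: "x \<in> space M" "y \<in> space M" "p b x \<noteq> 0" "p b y \<noteq> 0"
      and "k * p b x \<le> p a x" "p a y \<le> k * p b y" "l * p b x \<le> p c x" "p c y \<le> l * p b y" for x y
  proof -
    have "0 < p b x" "0 < p b y" using xy p_nonneg[OF \<Theta>(2)] by (simp_all add: order_less_le)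
    then have "p a x = k * p b x \<and> p a y = k * p b y \<or> p a y * p b x < p a x * p b y"
      "p c x = l * p b x \<and> p c y = l * p b y \<or> p c y * p b x < p c x * p b y"
      using that by (metis cross_mult_strict)+
    with mono[OF xy(1,2)] show ?thesis by argo
  qed
  \<comment> \<open>Adding the points where a ratio is undefined leaves it constant where defined,
    and lets the two sets also cover points with \<open>p b x = 0\<close>.\<close>
  define Ba where "Ba = {x \<in> space M. p b x \<noteq> 0 \<and> p a x = k * p b x \<or> p a x = 0 \<and> p b x = 0}"
  define Bc where "Bc = {x \<in> space M. p b x \<noteq> 0 \<and> p c x = l * p b x \<or> p b x = 0 \<and> p c x = 0}"
  have "ratio_constant_on p b a Ba"
    unfolding ratio_constant_on_def
  proof (intro exI ballI impI)
    fix x assume x: "x \<in> Ba" "ratio_defined p b a x"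
    then have "p b x \<noteq> 0" "x \<in> space M" "p a x = k * p b x" unfolding Ba_def ratio_defined_def by auto
    with p_nonneg[OF \<Theta>(2)] have b: "0 < p b x" by (simp add: order_less_le)
    \<comment> \<open>For \<open>k = 0\<close> the constant is infinite: \<open>p a\<close> vanishes
      where \<open>p b\<close> is positive.\<close>
    show "density_ratio p b a x = 1 / ennreal k"
    proof (cases "k = 0")
      case True
      have "ennreal (p b x) / 0 = \<top>" "(1 :: ennreal) / 0 = \<top>"
        using b by (simp_all add: ennreal_divide_eq_top_iff)
      with True \<open>p a x = _\<close> show ?thesis by (simp add: density_ratio_def)
    next
      case False
      with k(1) have k: "0 < k" by simp
      have "density_ratio p b a x = ennreal (p b x / (k * p b x))"
        unfolding density_ratio_def \<open>p a x = _\<close> using k b by (intro divide_ennreal) simp_all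
      also have "p b x / (k * p b x) = 1 / k" using b by simp
      also have "ennreal (1 / k) = 1 / ennreal k" using divide_ennreal[of 1 k] k by simp
      finally show ?thesis .
    qed
  qed
  moreover have "ratio_constant_on p c b Bc"
    unfolding ratio_constant_on_def
  proof (intro exI ballI impI)
    fix x assume x: "x \<in> Bc" "ratio_defined p c b x"
    then have "p b x \<noteq> 0" "x \<in> space M" "p c x = l * p b x" unfolding Bc_def ratio_defined_def by auto
    with p_nonneg[OF \<Theta>(2)] have b: "0 < p b x" by (simp add: order_less_le)
    with l(1) \<open>p c x = _\<close> show "density_ratio p c b x = ennreal l"
      unfolding density_ratio_def by (simp add: divide_ennreal)
  qed
  moreover have "AE x in M. x \<in> Ba \<union> Bc"
  proof -
    \<comment> \<open>The failures of the four a.e. bounds are collected in one null predicate, so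
      that individual points outside it can be chosen and compared by \<open>mid\<close>.\<close>
    define N where "N x \<longleftrightarrow> \<not> ((\<phi> x = 1 \<longrightarrow> k * p b x \<le> p a x \<and> l * p b x \<le> p c x) \<and>
      (\<phi> x = 0 \<longrightarrow> p b x \<noteq> 0 \<longrightarrow> p a x \<le> k * p b x \<and> p c x \<le> l * p b x))" for x
    have N: "AE x in M. \<not> N x"
      using k(2,3) l(2,3) unfolding N_def by eventually_elim auto
    have exU: "\<exists>x\<in>space M. \<not> N x \<and> p b x \<noteq> 0 \<and> \<phi> x = 1"
    proof (rule ccontr)
      assume neg: "\<not> ?thesis"
      from N AE_space have "AE x in M. p b x \<noteq> 0 \<longrightarrow> \<phi> x = 0"
        by eventually_elim (use neg decision_rule_cases(2)[OF \<phi>] in auto)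
      with n0 show False by simp
    qed
    have exV: "\<exists>x\<in>space M. \<not> N x \<and> p b x \<noteq> 0 \<and> \<phi> x = 0"
    proof (rule ccontr)
      assume neg: "\<not> ?thesis"
      from N AE_space have "AE x in M. p b x \<noteq> 0 \<longrightarrow> \<phi> x = 1"
        by eventually_elim (use neg decision_rule_cases(2)[OF \<phi>] in auto)
      with n1 show False by simp
    qed
    from N AE_space show ?thesis
    proof eventually_elim
      case (elim x)
      show ?case
      proof (cases "p b x = 0")
        case True
        \<comment> \<open>If both were positive, the zero of \<open>p b\<close> at \<open>x\<close>
          would spread downwards against \<open>p a\<close> and upwards against \<open>p c\<close>,
          making \<open>p b\<close> identically 0.\<close>
        have "p a x = 0 \<or> p c x = 0"
        proof (rule ccontr)
          assume ac: "\<not> ?thesis"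
          have "p b y = 0" if "y \<in> space M" for y
          proof (cases "T y \<le> T x")
            case le: True
            show ?thesis by (rule zero_below[of a b x y]) (use \<Theta> lt elim ac True that le in simp_all)
          next
            case le: False
            show ?thesis by (rule zero_above[of b c x y]) (use \<Theta> lt elim ac True that le in simp_all)
          qed
          with not_AE_zero[OF \<Theta>(2)] show False by (auto intro: AE_I2)
        qed
        with True elim show ?thesis unfolding Ba_def Bc_def by auto
      next
        case False
        have "p a x = k * p b x \<or> p c x = l * p b x"
        proof (cases "\<phi> x = 1")
          case True
          obtain y where "y \<in> space M" "\<not> N y" "p b y \<noteq> 0" "\<phi> y = 0" using exV by blast
          then show ?thesis using mid[of x y] elim False True unfolding N_def by auto
        next
          case 0: False
          then have "\<phi> x = 0" using elim decision_rule_cases(2)[OF \<phi>] by auto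
          obtain y where "y \<in> space M" "\<not> N y" "p b y \<noteq> 0" "\<phi> y = 1" using exU by blast
          then show ?thesis using mid[of y x] elim False \<open>\<phi> x = 0\<close> unfolding N_def by auto
        qed
        with False elim show ?thesis unfolding Ba_def Bc_def by auto
      qed
    qed
  qed
  ultimately show ?thesis by (intro that[of Ba Bc]) (simp_all add: Ba_def Bc_def)
qed

text \<open>Where \<open>p\<^sub>b > 0 = p\<^sub>b\<^sub>'\<close> with \<open>b < b'\<close>, every \<open>p\<^sub>c\<close> with \<open>c > b'\<close> vanishes too. So if \<open>\<phi> = 1\<close> with positive
  \<open>P\<^sub>b\<close>-probability, no pair \<open>(b, c)\<close> is separated by expertise, whence \<open>\<phi> = 1\<close> \<open>P\<^sub>c\<close>-a.s. for all \<open>c\<close> while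
  \<open>\<phi> = 0\<close> \<open>P\<^sub>b\<^sub>'\<close>-a.s.; this puts \<open>P\<^sub>b\<^sub>'\<close> inside the common zero set of the \<open>p\<^sub>c\<close>, against purity.\<close>

lemma rejects_earlier:
  assumes \<Theta>: "b \<in> \<Theta>" "b' \<in> \<Theta>" "R \<subseteq> \<Theta>"
    and lt: "lt b b'" "\<And>c. c \<in> R \<Longrightarrow> lt b' c"
    and sep: "\<And>c. c \<in> R \<Longrightarrow> separates \<phi> b c" and \<phi>: "decision_rule M \<phi>"
    and b': "AE x in M. p b' x \<noteq> 0 \<longrightarrow> \<phi> x = 0"
    and pure: "\<not> (AE x in M. p b' x \<noteq> 0 \<longrightarrow> x \<in> vanish_below M p T R)"
  shows "AE x in M. p b x \<noteq> 0 \<longrightarrow> \<phi> x = 0"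
proof (rule ccontr)
  assume neg: "\<not> ?thesis"
  note [measurable] = decision_rule_cases(1)[OF \<phi>] p_measurable[OF \<Theta>(1)] p_measurable[OF \<Theta>(2)]
  define W where "W = {x \<in> space M. p b x \<noteq> 0 \<and> p b' x = 0}"
  have W: "W \<in> sets M" unfolding W_def by measurable
  have "AE x in M. p c x \<noteq> 0 \<longrightarrow> \<not> \<phi> x = 0" if c: "c \<in> R" for c
  proof -
    have c\<Theta>: "c \<in> \<Theta>" using \<Theta> c by auto
    have "p c x = 0" if x: "x \<in> W" for x
    proof (rule ccontr)
      assume cx: "p c x \<noteq> 0"
      have "p b' y = 0" if "y \<in> space M" for y
      proof (cases "T y \<le> T x")
        case le: True
        show ?thesis by (rule zero_below[of b b' x y]) (use \<Theta> lt x that le in \<open>simp_all add: W_def\<close>)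
      next
        case le: False
        show ?thesis
          by (rule zero_above[of b' c x y]) (use \<Theta> c\<Theta> lt c x cx that le in \<open>simp_all add: W_def\<close>)
      qed
      with not_AE_zero[OF \<Theta>(2)] show False by (auto intro: AE_I2)
    qed
    then have c0: "AE x in M. x \<in> W \<longrightarrow> p c x = 0" by simp
    have "\<not> expert_between_two M (distr_of M p b) (distr_of M p c) \<phi>"
    proof
      assume "expert_between_two M (distr_of M p b) (distr_of M p c) \<phi>"
      from expert_null(2)[OF this \<Theta>(1) c\<Theta> W c0] b' AE_space
      have "AE x in M. p b x \<noteq> 0 \<longrightarrow> \<phi> x = 0"
        by eventually_elim (use decision_rule_cases(2)[OF \<phi>] in \<open>auto simp: W_def\<close>)
      with neg show False by simp
    qed
    with sep[OF c] neg have "AE x in M. p c x \<noteq> 0 \<longrightarrow> \<phi> x = 1" unfolding separates_def by blast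
    then show ?thesis by eventually_elim auto
  qed
  then have "AE x in M. p b' x \<noteq> 0 \<longrightarrow> \<phi> x = 0 \<longrightarrow> x \<in> vanish_below M p T R"
    using \<Theta> lt by (intro AE_vanish_below)
  with b' have "AE x in M. p b' x \<noteq> 0 \<longrightarrow> x \<in> vanish_below M p T R"
    by eventually_elim auto
  with pure show False by simp
qed

text \<open>Suppose \<open>\<phi> = 1\<close> fails with positive mass for \<open>a\<close>. Then
  \<open>(b, a)\<close> is separated by expertise, so \<open>b\<close> gives no mass to
  \<open>F\<close> within \<open>{\<phi> = 1}\<close>. Expertise for some \<open>(b, c)\<close>
  would say the same of the other zero set, and \<open>cov\<close> would contradict
  \<open>n0\<close>. So \<open>\<phi> = 1\<close> a.s. for every \<open>c \<in> R\<close>, which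
  places \<open>{\<phi> = 0}\<close> a.s. for \<open>b\<close> in the zero set of \<open>R\<close>;
  with \<open>cov\<close> all the mass of \<open>b\<close> lies there, against purity.\<close>

lemma accepts_if_negligible_overlap:
  assumes \<Theta>: "a \<in> \<Theta>" "b \<in> \<Theta>" "R \<subseteq> \<Theta>" and lt: "\<And>c. c \<in> R \<Longrightarrow> lt b c"
    and sep: "separates \<phi> b a" "\<And>c. c \<in> R \<Longrightarrow> separates \<phi> b c"
    and F: "F \<in> sets M" "\<And>x. x \<in> F \<Longrightarrow> p a x = 0"
    and G: "vanish_below M p T R \<in> sets M"
    and cov: "AE x in M. p b x \<noteq> 0 \<longrightarrow> x \<in> F \<union> vanish_below M p T R"
    and pure: "\<not> (AE x in M. p b x \<noteq> 0 \<longrightarrow> x \<in> vanish_below M p T R)"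
    and n0: "\<not> (AE x in M. p b x \<noteq> 0 \<longrightarrow> \<phi> x = 0)"
  shows "AE x in M. p a x \<noteq> 0 \<longrightarrow> \<phi> x = 1"
proof (rule ccontr)
  assume neg: "\<not> ?thesis"
  have \<phi>: "decision_rule M \<phi>" using sep unfolding separates_def by simp
  have ea: "expert_between_two M (distr_of M p b) (distr_of M p a) \<phi>"
    using neg n0 sep(1) unfolding separates_def by blast
  have F0: "AE x in M. x \<in> F \<longrightarrow> \<phi> x = 1 \<longrightarrow> p b x = 0"
    by (rule expert_null(2)[OF ea \<Theta>(2,1) F(1)]) (simp add: F(2))
  have "AE x in M. p c x \<noteq> 0 \<longrightarrow> \<not> \<phi> x = 0" if c: "c \<in> R" for c
  proof -
    have "\<not> expert_between_two M (distr_of M p b) (distr_of M p c) \<phi>"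
    proof
      assume ec: "expert_between_two M (distr_of M p b) (distr_of M p c) \<phi>"
      have "AE x in M. x \<in> vanish_below M p T R \<longrightarrow> p c x = 0"
        using c by (auto simp: vanish_below_def)
      from expert_null(2)[OF ec \<Theta>(2) _ G this] c \<Theta>(3)
      have "AE x in M. x \<in> vanish_below M p T R \<longrightarrow> \<phi> x = 1 \<longrightarrow> p b x = 0" by auto
      with F0 cov AE_space have "AE x in M. p b x \<noteq> 0 \<longrightarrow> \<phi> x = 0"
        by eventually_elim (use decision_rule_cases(2)[OF \<phi>] in auto)
      with n0 show False by simp
    qed
    with sep(2)[OF c] n0 have "AE x in M. p c x \<noteq> 0 \<longrightarrow> \<phi> x = 1" unfolding separates_def by blast
    then show ?thesis by eventually_elim auto
  qed
  then have "AE x in M. p b x \<noteq> 0 \<longrightarrow> \<phi> x = 0 \<longrightarrow> x \<in> vanish_below M p T R"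
    using \<Theta> lt by (intro AE_vanish_below)
  with F0 cov AE_space have "AE x in M. p b x \<noteq> 0 \<longrightarrow> x \<in> vanish_below M p T R"
    by eventually_elim (use decision_rule_cases(2)[OF \<phi>] in auto)
  with pure show False by simp
qed

text \<open>The event \<open>{\<phi> = 0}\<close> is null for \<open>b\<close>, and expertise
  carries this over to \<open>t\<close>. The alternative \<open>\<phi> = 0\<close> a.s. for
  \<open>b\<close> would leave \<open>b\<close> without mass.\<close>

lemma accepts_if_accepts_middle:
  assumes \<Theta>: "b \<in> \<Theta>" "t \<in> \<Theta>" and sep: "separates \<phi> b t"
    and b: "AE x in M. p b x \<noteq> 0 \<longrightarrow> \<phi> x = 1"
  shows "AE x in M. p t x \<noteq> 0 \<longrightarrow> \<phi> x = 1"
proof -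
  have \<phi>: "decision_rule M \<phi>" using sep unfolding separates_def by simp
  note [measurable] = decision_rule_cases(1)[OF \<phi>]
  have "\<not> (AE x in M. p b x \<noteq> 0 \<longrightarrow> \<phi> x = 0)"
  proof
    assume "AE x in M. p b x \<noteq> 0 \<longrightarrow> \<phi> x = 0"
    with b have "AE x in M. p b x = 0" by eventually_elim auto
    with not_AE_zero[OF \<Theta>(1)] show False by simp
  qed
  moreover have ?thesis if ex: "expert_between_two M (distr_of M p b) (distr_of M p t) \<phi>"
  proof -
    have "{x \<in> space M. \<phi> x = 0} \<in> sets M" by measurable
    moreover have "AE x in M. x \<in> {x \<in> space M. \<phi> x = 0} \<longrightarrow> p b x = 0"
      using b by eventually_elim auto
    ultimately have "AE x in M. x \<in> {x \<in> space M. \<phi> x = 0} \<longrightarrow> \<phi> x = 0 \<longrightarrow> p t x = 0"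
      by (rule expert_null(1)[OF ex \<Theta>])
    with AE_space show ?thesis
      by eventually_elim (use decision_rule_cases(2)[OF \<phi>] in auto)
  qed
  ultimately show ?thesis using sep unfolding separates_def by blast
qed

section \<open>Zero sets as preimages of half-lines\<close>

text \<open>A parameter in \<open>S\<close> has a density that is not identically 0, so the greatest
  half-line exists. One inclusion tests its maximality on \<open>{..T x}\<close>, the other uses
  that it is downward closed.\<close>

lemma vanish_below_eq_D_low:
  assumes "S \<subseteq> \<Theta>" "S \<noteq> {}"
  shows "lower_half_line (D_low M p T S)"
    and "x \<in> space M \<Longrightarrow> x \<in> vanish_below M p T S \<longleftrightarrow> T x \<in> D_low M p T S"
proof -
  obtain \<theta> where \<theta>: "\<theta> \<in> S" using assms by auto
  then obtain x0 where x0: "x0 \<in> space M" "p \<theta> x0 \<noteq> 0"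
    using not_AE_zero[of \<theta>] assms by (auto intro: AE_I2)
  note D = D_low_greatest[of \<theta> S x0 M p, OF \<theta> x0]
  show l: "lower_half_line (D_low M p T S)" by (rule D(1))
  assume x: "x \<in> space M"
  show "x \<in> vanish_below M p T S \<longleftrightarrow> T x \<in> D_low M p T S"
  proof
    assume "x \<in> vanish_below M p T S"
    then have "densities_vanish M p T S {..T x}"
      by (simp add: densities_vanish_def vanish_below_def)
    moreover have "lower_half_line {..T x}" unfolding lower_half_line_def by blast
    ultimately have "{..T x} \<subseteq> D_low M p T S" by (intro D(3))
    then show "T x \<in> D_low M p T S" by auto
  next
    assume Tx: "T x \<in> D_low M p T S"
    have "t \<in> D_low M p T S" if "t \<le> T x" for t
      using Tx l that unfolding lower_half_line_def by force
    then show "x \<in> vanish_below M p T S"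
      using D(2)[of T] x by (simp add: densities_vanish_def vanish_below_def)
  qed
qed

text \<open>Argued afresh, since \<open>dual\<close> would yield \<open>D_low\<close> for
  \<open>- T\<close> rather than \<open>D_up\<close> for \<open>T\<close>.\<close>

lemma vanish_above_eq_D_up:
  assumes "S \<subseteq> \<Theta>" "S \<noteq> {}"
    and x: "x \<in> space M"
  shows "x \<in> vanish_below M p (\<lambda>x. - T x) S \<longleftrightarrow> T x \<in> D_up M p T S"
proof -
  obtain \<theta> where \<theta>: "\<theta> \<in> S" using assms by auto
  then obtain x0 where x0: "x0 \<in> space M" "p \<theta> x0 \<noteq> 0"
    using not_AE_zero[of \<theta>] assms by (auto intro: AE_I2)
  note D = D_up_greatest[of \<theta> S x0 M p, OF \<theta> x0]
  have l: "upper_half_line (D_up M p T S)" by (rule D(1))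
  show "x \<in> vanish_below M p (\<lambda>x. - T x) S \<longleftrightarrow> T x \<in> D_up M p T S"
  proof
    assume "x \<in> vanish_below M p (\<lambda>x. - T x) S"
    then have "densities_vanish M p T S {T x..}"
      by (simp add: densities_vanish_def vanish_below_def)
    moreover have "upper_half_line {T x..}" unfolding upper_half_line_def by blast
    ultimately have "{T x..} \<subseteq> D_up M p T S" by (intro D(3))
    then show "T x \<in> D_up M p T S" by auto
  next
    assume Tx: "T x \<in> D_up M p T S"
    have "t \<in> D_up M p T S" if "T x \<le> t" for t
      using Tx l that unfolding upper_half_line_def by force
    then show "x \<in> vanish_below M p (\<lambda>x. - T x) S"
      using D(2)[of T] x by (simp add: densities_vanish_def vanish_below_def)
  qed
qed

lemma vanish_below_sets:
  assumes "S \<subseteq> \<Theta>" "S \<noteq> {}"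
  shows "vanish_below M p T S \<in> sets M"
proof -
  consider "D_low M p T S = {}" | a where "D_low M p T S = {..<a}" | a where "D_low M p T S = {..a}"
    using vanish_below_eq_D_low(1)[OF assms] unfolding lower_half_line_def by blast
  then have "D_low M p T S \<in> sets borel" by cases simp_all
  then have "T -` D_low M p T S \<inter> space M \<in> sets M" by (rule measurable_sets[OF T_measurable])
  moreover have "T -` D_low M p T S \<inter> space M = vanish_below M p T S"
  proof (rule set_eqI)
    fix x
    have "x \<in> vanish_below M p T S \<Longrightarrow> x \<in> space M" unfolding vanish_below_def by simp
    then show "x \<in> T -` D_low M p T S \<inter> space M \<longleftrightarrow> x \<in> vanish_below M p T S"
      using vanish_below_eq_D_low(2)[OF assms, of x] by blast
  qed
  ultimately show ?thesis by simp
qed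

section \<open>The dichotomy for experts\<close>

lemma experts_trivial:
  assumes \<Theta>: "L \<subseteq> \<Theta>" "Z \<subseteq> \<Theta>" "R \<subseteq> \<Theta>" and ne: "L \<noteq> {}" "Z \<noteq> {}" "R \<noteq> {}"
    and lt: "\<And>a b. a \<in> L \<Longrightarrow> b \<in> Z \<Longrightarrow> lt a b" "\<And>b c. b \<in> Z \<Longrightarrow> c \<in> R \<Longrightarrow> lt b c"
      "\<And>b b'. b \<in> Z \<Longrightarrow> b' \<in> Z \<Longrightarrow> b \<noteq> b' \<Longrightarrow> lt b b' \<or> lt b' b"
    and sep: "\<And>b t. b \<in> Z \<Longrightarrow> t \<in> L \<union> R \<Longrightarrow> separates \<phi> b t"
    and pure: "\<And>b. b \<in> Z \<Longrightarrow> \<not> (AE x in M. p b x \<noteq> 0 \<longrightarrow> x \<in> vanish_below M p T R)"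
      "\<And>b. b \<in> Z \<Longrightarrow> \<not> (AE x in M. p b x \<noteq> 0 \<longrightarrow> x \<in> vanish_below M p (\<lambda>x. - T x) L)"
    and overlap: "(\<forall>b\<in>Z. AE x in M. p b x \<noteq> 0 \<longrightarrow> x \<in> vanish_below M p T R \<union> vanish_below M p (\<lambda>x. - T x) L) \<or>
      (\<exists>a\<in>L. \<exists>b\<in>Z. \<exists>c\<in>R. \<not> (\<exists>Ba\<in>sets M. \<exists>Bc\<in>sets M. (AE x in M. x \<in> Ba \<union> Bc) \<and>
        ratio_constant_on p b a Ba \<and> ratio_constant_on p c b Bc))"
  shows "(\<forall>b\<in>Z. AE x in M. p b x \<noteq> 0 \<longrightarrow> \<phi> x = 0) \<or> (\<forall>t\<in>L \<union> R. AE x in M. p t x \<noteq> 0 \<longrightarrow> \<phi> x = 1)"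
proof -
  interpret dual: ordered_likelihood M p \<Theta> "\<lambda>x. - T x" "\<lambda>s t. lt t s" by (rule dual)
  have \<phi>: "decision_rule M \<phi>" using ne sep unfolding separates_def by blast
  have G: "vanish_below M p T R \<in> sets M" "vanish_below M p (\<lambda>x. - T x) L \<in> sets M"
    using vanish_below_sets[of R] dual.vanish_below_sets[of L] \<Theta> ne by auto
  from overlap show ?thesis
  proof
    assume cov: "\<forall>b\<in>Z. AE x in M. p b x \<noteq> 0 \<longrightarrow> x \<in> vanish_below M p T R \<union> vanish_below M p (\<lambda>x. - T x) L"
    have "AE x in M. p t x \<noteq> 0 \<longrightarrow> \<phi> x = 1"
      if b: "b \<in> Z" "\<not> (AE x in M. p b x \<noteq> 0 \<longrightarrow> \<phi> x = 0)" and t: "t \<in> L \<union> R" for b t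
      using t
    proof
      \<comment> \<open>\<open>F\<close> is the upper zero set of the block \<open>L\<close> that
        contains \<open>t\<close>; for \<open>t \<in> R\<close> the reversed order exchanges the two
        zero sets.\<close>
      assume "t \<in> L"
      then show ?thesis
        using \<Theta> lt sep pure b G cov
        by (intro accepts_if_negligible_overlap[of t b R \<phi> "vanish_below M p (\<lambda>x. - T x) L"])
          (auto simp: vanish_below_def[of _ _ _ L] Un_commute)
    next
      assume "t \<in> R"
      then show ?thesis
        using \<Theta> lt sep pure b G cov
        by (intro dual.accepts_if_negligible_overlap[of t b L \<phi> "vanish_below M p T R"])
          (auto simp: vanish_below_def[of _ _ _ R])
    qed
    then show ?thesis by blast
  next
    assume "\<exists>a\<in>L. \<exists>b\<in>Z. \<exists>c\<in>R. \<not> (\<exists>Ba\<in>sets M. \<exists>Bc\<in>sets M. (AE x in M. x \<in> Ba \<union> Bc) \<and>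
        ratio_constant_on p b a Ba \<and> ratio_constant_on p c b Bc)"
    then obtain a b c where abc: "a \<in> L" "b \<in> Z" "c \<in> R" and
      ncov: "\<not> (\<exists>Ba\<in>sets M. \<exists>Bc\<in>sets M. (AE x in M. x \<in> Ba \<union> Bc) \<and>
        ratio_constant_on p b a Ba \<and> ratio_constant_on p c b Bc)" by blast
    have "(AE x in M. p b x \<noteq> 0 \<longrightarrow> \<phi> x = 0) \<or> (AE x in M. p b x \<noteq> 0 \<longrightarrow> \<phi> x = 1)"
    proof (rule ccontr)
      assume neg: "\<not> ?thesis"
      obtain Ba Bc where "Ba \<in> sets M" "Bc \<in> sets M"
        "ratio_constant_on p b a Ba" "ratio_constant_on p c b Bc" "AE x in M. x \<in> Ba \<union> Bc"
        by (rule ratio_cover[of a b c \<phi>]) (use \<Theta> abc lt sep neg in auto)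
      with ncov show False by blast
    qed
    then show ?thesis
    proof
      assume b: "AE x in M. p b x \<noteq> 0 \<longrightarrow> \<phi> x = 0"
      have "AE x in M. p b' x \<noteq> 0 \<longrightarrow> \<phi> x = 0" if b': "b' \<in> Z" for b'
      proof -
        consider "b' = b" | "lt b' b" | "lt b b'" using lt(3)[OF abc(2) b'] by blast
        then show ?thesis
        proof cases
          \<comment> \<open>A parameter before \<open>b\<close> is reached directly, one after
            \<open>b\<close> through the reversed order.\<close>
          case 2
          show ?thesis
            by (rule rejects_earlier[of b' b R]) (use 2 b b' abc \<Theta> lt sep \<phi> pure in auto)
        next
          case 3
          show ?thesis
            by (rule dual.rejects_earlier[of b' b L]) (use 3 b b' abc \<Theta> lt sep \<phi> pure in auto)
        qed (use b in simp)
      qed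
      then show ?thesis by blast
    next
      assume b: "AE x in M. p b x \<noteq> 0 \<longrightarrow> \<phi> x = 1"
      have "AE x in M. p t x \<noteq> 0 \<longrightarrow> \<phi> x = 1" if "t \<in> L \<union> R" for t
        by (rule accepts_if_accepts_middle[of b t]) (use that b abc \<Theta> sep in auto)
      then show ?thesis by blast
    qed
  qed
qed

lemma almost_surely_iff:
  "S \<subseteq> \<Theta> \<Longrightarrow> almost_surely M p S Q \<longleftrightarrow> (\<forall>\<theta>\<in>S. AE x in M. p \<theta> x \<noteq> 0 \<longrightarrow> Q x)"
  unfolding almost_surely_def by (intro ball_cong) (auto simp: AE_distr subsetD)

lemma negligible_event_iff:
  "S \<subseteq> \<Theta> \<Longrightarrow> A \<in> sets M \<Longrightarrow> negligible_event M p S A \<longleftrightarrow> (\<forall>\<theta>\<in>S. AE x in M. p \<theta> x \<noteq> 0 \<longrightarrow> x \<notin> A)"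
  unfolding negligible_event_def
  by (intro ball_cong) (auto simp: AE_distr[symmetric] subsetD AE_iff_null_sets)

end

section \<open>From the monotone likelihood ratio to the trivial experts\<close>

text \<open>If a factor on the left is 0, nonnegativity suffices. Otherwise the ratio is defined at
  both points and finite at \<open>y\<close>, hence finite at \<open>x\<close> by monotonicity, and
  the denominators can be cleared.\<close>

lemma likelihood_ratio_cross:
  assumes model: "statistical_model M p \<Theta>" and mlr: "monotone_likelihood_ratio M p \<Theta> T"
    and st: "s \<in> \<Theta>" "t \<in> \<Theta>" "s < t" and xy: "x \<in> space M" "y \<in> space M" "T x \<le> T y"
  shows "p t x * p s y \<le> p s x * p t y"
proof -
  have nn: "0 \<le> p s x" "0 \<le> p s y" "0 \<le> p t x" "0 \<le> p t y"
    using model st xy unfolding statistical_model_def by auto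
  obtain h :: "real \<Rightarrow> ennreal" where h: "mono h"
    "\<And>x. x \<in> space M \<Longrightarrow> ratio_defined p t s x \<Longrightarrow> density_ratio p t s x = h (T x)"
    using mlr st unfolding monotone_likelihood_ratio_def by blast
  show ?thesis
  proof (cases "p t x = 0 \<or> p s y = 0")
    case True
    then show ?thesis using nn by auto
  next
    case False
    then have "density_ratio p t s x \<le> density_ratio p t s y"
      using h(2)[of x] h(2)[of y] monoD[OF h(1) xy(3)] xy by (simp add: ratio_defined_def)
    moreover have pos: "0 < p t x" "0 < p s y" using False nn by auto
    ultimately have le: "ennreal (p t x) / ennreal (p s x) \<le> ennreal (p t y / p s y)"
      using nn by (simp add: density_ratio_def divide_ennreal)
    have "p s x \<noteq> 0"
    proof
      assume "p s x = 0"
      then have "ennreal (p t x) / ennreal (p s x) = \<top>" using pos by (simp add: ennreal_divide_eq_top_iff)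
      with le show False by (simp add: top_unique)
    qed
    then have "0 < p s x" using nn by simp
    with le pos nn have "p t x / p s x \<le> p t y / p s y"
      by (simp add: divide_ennreal)
    with \<open>0 < p s x\<close> pos show ?thesis by (simp add: field_simps)
  qed
qed

lemma ordered_likelihood_if_monotone:
  assumes "statistical_model M p \<Theta>" "monotone_likelihood_ratio M p \<Theta> T"
  shows "ordered_likelihood M p \<Theta> T (<)"
  using assms likelihood_ratio_cross[OF assms]
  by (intro ordered_likelihood.intro) (auto simp: statistical_model_def monotone_likelihood_ratio_def)

theorem proposition5p3p2:
  fixes M :: "'a measure" and p :: "real \<Rightarrow> 'a \<Rightarrow> real" and T :: "'a \<Rightarrow> real"
    and \<Theta> \<Theta>1' \<Theta>0' \<Theta>1'' \<Theta>0'' \<Theta>1 \<Theta>0 :: "real set" and B :: "'a set"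
  assumes "statistical_model M p \<Theta>"
    and "monotone_likelihood_ratio M p \<Theta> T"
    and "two_sided_hypotheses \<Theta> \<Theta>1' \<Theta>0' \<Theta>1'' \<Theta>0'' \<Theta>1 \<Theta>0"
    and "pure_two_sided M p T \<Theta>1' \<Theta>0'' \<Theta>0"
    and "B = T -` (UNIV - D_low M p T \<Theta>0'' - D_up M p T \<Theta>1') \<inter> space M"
    and "negligible_event M p \<Theta> B \<or>
         (\<not> negligible_event M p \<Theta> B \<and>
          (\<exists>\<theta>a\<in>\<Theta>1'. \<exists>\<theta>b\<in>\<Theta>0. \<exists>\<theta>c\<in>\<Theta>0''.
             \<not> (\<exists>Ba\<in>sets M. \<exists>Bc\<in>sets M.
                  negligible_event M p \<Theta> (B - (Ba \<union> Bc)) \<and>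
                  ratio_constant_on p \<theta>b \<theta>a Ba \<and> ratio_constant_on p \<theta>c \<theta>b Bc)))"
  shows "{\<phi>. expert M p \<Theta>0 \<Theta>1 \<phi>} =
         {\<phi>. decision_rule M \<phi> \<and>
            (almost_surely M p \<Theta>
               (\<lambda>x. \<phi> x = indicat_real (D_low M p T \<Theta>0 \<union> D_up M p T \<Theta>0) (T x)) \<or>
             almost_surely M p \<Theta>
               (\<lambda>x. \<phi> x = 1 - indicat_real (D_low M p T \<Theta>0'' \<inter> D_up M p T \<Theta>1') (T x)))}"
proof -
  interpret ordered_likelihood M p \<Theta> T "(<)"
    by (rule ordered_likelihood_if_monotone[OF assms(1,2)])
  interpret dual: ordered_likelihood M p \<Theta> "\<lambda>x. - T x" "\<lambda>s t. t < s" by (rule dual)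
  have \<Theta>: "\<Theta>1' \<subseteq> \<Theta>" "\<Theta>0 \<subseteq> \<Theta>" "\<Theta>0'' \<subseteq> \<Theta>" "\<Theta>1 \<subseteq> \<Theta>"
    and \<Theta>_eq: "\<Theta> = \<Theta>1' \<union> \<Theta>0 \<union> \<Theta>0''" "\<Theta>1 = \<Theta>1' \<union> \<Theta>0''"
    and ne: "\<Theta>1' \<noteq> {}" "\<Theta>0 \<noteq> {}" "\<Theta>0'' \<noteq> {}"
    and lt: "\<And>a b. a \<in> \<Theta>1' \<Longrightarrow> b \<in> \<Theta>0 \<Longrightarrow> a < b" "\<And>b c. b \<in> \<Theta>0 \<Longrightarrow> c \<in> \<Theta>0'' \<Longrightarrow> b < c"
    using assms(3) unfolding two_sided_hypotheses_def one_sided_hypotheses_def by blast+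
  let ?up = "\<lambda>S. vanish_below M p (\<lambda>x. - T x) S" and ?low = "\<lambda>S. vanish_below M p T S"
  have low: "T x \<in> D_low M p T S \<longleftrightarrow> x \<in> ?low S" if "S = \<Theta>0 \<or> S = \<Theta>0''" "x \<in> space M" for x S
    using vanish_below_eq_D_low(2)[of S x] that \<Theta> ne by auto
  have up: "T x \<in> D_up M p T S \<longleftrightarrow> x \<in> ?up S" if "S = \<Theta>0 \<or> S = \<Theta>1'" "x \<in> space M" for x S
    using vanish_above_eq_D_up[of S x] that \<Theta> ne by auto
  have vanish: "p \<theta> x = 0" if "x \<in> ?low S \<or> x \<in> ?up S" "\<theta> \<in> S" for x \<theta> S
    using that unfolding vanish_below_def by auto
  have sets [measurable]: "?low \<Theta>0 \<in> sets M" "?low \<Theta>0'' \<in> sets M" "?up \<Theta>0 \<in> sets M" "?up \<Theta>1' \<in> sets M"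
    using vanish_below_sets dual.vanish_below_sets \<Theta> ne by simp_all
  \<comment> \<open>In the sample space, \<open>D0\<close> and \<open>D1\<close> are the preimages
    under \<open>T\<close> of the sets occurring in the two trivial experts.\<close>
  define D0 where "D0 = ?low \<Theta>0 \<union> ?up \<Theta>0"
  define D1 where "D1 = ?low \<Theta>0'' \<inter> ?up \<Theta>1'"
  have D_sets: "D0 \<in> sets M" "D1 \<in> sets M" unfolding D0_def D1_def by simp_all
  have as0: "almost_surely M p \<Theta> (\<lambda>x. \<phi> x = indicat_real (D_low M p T \<Theta>0 \<union> D_up M p T \<Theta>0) (T x)) \<longleftrightarrow>
      (\<forall>\<theta>\<in>\<Theta>. AE x in M. p \<theta> x \<noteq> 0 \<longrightarrow> \<phi> x = indicator D0 x)" for \<phi>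
    unfolding almost_surely_iff[OF subset_refl] D0_def
    by (intro ball_cong AE_cong) (auto simp: indicator_def low up)
  have as1: "almost_surely M p \<Theta> (\<lambda>x. \<phi> x = 1 - indicat_real (D_low M p T \<Theta>0'' \<inter> D_up M p T \<Theta>1') (T x)) \<longleftrightarrow>
      (\<forall>\<theta>\<in>\<Theta>. AE x in M. p \<theta> x \<noteq> 0 \<longrightarrow> \<phi> x = 1 - indicator D1 x)" for \<phi>
    unfolding almost_surely_iff[OF subset_refl] D1_def
    by (intro ball_cong AE_cong) (auto simp: indicator_def low up)
  \<comment> \<open>Parameters below the middle block lead to its lower zero set, those above it to
    its upper one; hence a union.\<close>
  have in_D0: "AE x in M. p \<theta> x \<noteq> 0 \<longrightarrow> Q x \<longrightarrow> x \<in> D0"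
    if "\<And>b. b \<in> \<Theta>0 \<Longrightarrow> AE x in M. p b x \<noteq> 0 \<longrightarrow> \<not> Q x" "\<theta> \<in> \<Theta>1" for Q \<theta>
  proof -
    from that(2) consider "\<theta> \<in> \<Theta>1'" | "\<theta> \<in> \<Theta>0''" using \<Theta>_eq by blast
    then show ?thesis
    proof cases
      case 1
      then have "AE x in M. p \<theta> x \<noteq> 0 \<longrightarrow> Q x \<longrightarrow> x \<in> ?low \<Theta>0"
        by (intro AE_vanish_below) (use \<Theta> lt that(1) in auto)
      then show ?thesis by eventually_elim (auto simp: D0_def)
    next
      case 2
      then have "AE x in M. p \<theta> x \<noteq> 0 \<longrightarrow> Q x \<longrightarrow> x \<in> ?up \<Theta>0"
        by (intro dual.AE_vanish_below) (use \<Theta> lt that(1) in auto)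
      then show ?thesis by eventually_elim (auto simp: D0_def)
    qed
  qed
  \<comment> \<open>A middle parameter has one block on each side and is forced into both zero sets;
    hence an intersection.\<close>
  have in_D1: "AE x in M. p b x \<noteq> 0 \<longrightarrow> Q x \<longrightarrow> x \<in> D1"
    if "\<And>\<theta>. \<theta> \<in> \<Theta>1 \<Longrightarrow> AE x in M. p \<theta> x \<noteq> 0 \<longrightarrow> \<not> Q x" "b \<in> \<Theta>0" for Q b
  proof -
    have "AE x in M. p b x \<noteq> 0 \<longrightarrow> Q x \<longrightarrow> x \<in> ?low \<Theta>0''"
      by (intro AE_vanish_below) (use \<Theta> \<Theta>_eq lt that in auto)
    moreover have "AE x in M. p b x \<noteq> 0 \<longrightarrow> Q x \<longrightarrow> x \<in> ?up \<Theta>1'"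
      by (intro dual.AE_vanish_below) (use \<Theta> \<Theta>_eq lt that in auto)
    ultimately show ?thesis by eventually_elim (auto simp: D1_def)
  qed
  have D0_vanish: "p b x = 0" if "b \<in> \<Theta>0" "x \<in> D0" for b x
    using vanish[of x \<Theta>0 b] that unfolding D0_def by auto
  have D1_vanish: "p \<theta> x = 0" if "\<theta> \<in> \<Theta>1" "x \<in> D1" for \<theta> x
    using vanish[of x \<Theta>1' \<theta>] vanish[of x \<Theta>0'' \<theta>] that \<Theta>_eq unfolding D1_def by auto
  have expert_iff: "expert M p \<Theta>0 \<Theta>1 \<phi> \<longleftrightarrow> (\<forall>b\<in>\<Theta>0. \<forall>t\<in>\<Theta>1. separates \<phi> b t) \<and>
     (\<forall>A\<in>sets M.
        ((\<forall>b\<in>\<Theta>0. AE x in M. p b x \<noteq> 0 \<longrightarrow> x \<notin> A) \<longrightarrow>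
           (\<forall>t\<in>\<Theta>1. AE x in M. p t x \<noteq> 0 \<longrightarrow> x \<in> A \<longrightarrow> \<phi> x = 1)) \<and>
        ((\<forall>t\<in>\<Theta>1. AE x in M. p t x \<noteq> 0 \<longrightarrow> x \<notin> A) \<longrightarrow>
           (\<forall>b\<in>\<Theta>0. AE x in M. p b x \<noteq> 0 \<longrightarrow> x \<in> A \<longrightarrow> \<phi> x = 0)))"
    if \<phi>: "decision_rule M \<phi>" for \<phi>
  proof -
    have *: "(indicat_real A x = 0) = (x \<notin> A)" "(\<phi> x * indicat_real A x = indicat_real A x) = (x \<in> A \<longrightarrow> \<phi> x = 1)"
      "(\<phi> x * indicat_real A x = 0) = (x \<in> A \<longrightarrow> \<phi> x = 0)" for A x by (auto simp: indicator_def)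
    have **: "(expert_between_two M (distr_of M p b) (distr_of M p t) \<phi> \<or>
        (\<integral>x. \<phi> x \<partial>distr_of M p b) = 0 \<or> (\<integral>x. \<phi> x \<partial>distr_of M p t) = 1) \<longleftrightarrow> separates \<phi> b t"
      if "b \<in> \<Theta>0" "t \<in> \<Theta>1" for b t
      using \<phi> that \<Theta> integral_eq_0_iff[OF \<phi>, of b] integral_eq_1_iff[OF \<phi>, of t]
      unfolding separates_def by auto
    show ?thesis
      unfolding expert_def almost_surely_iff[OF \<Theta>(2)] almost_surely_iff[OF \<Theta>(4)] *
      using \<phi> ** by (simp cong: ball_cong)
  qed
  have pure: "\<not> (AE x in M. p b x \<noteq> 0 \<longrightarrow> x \<in> ?low \<Theta>0'')" "\<not> (AE x in M. p b x \<noteq> 0 \<longrightarrow> x \<in> ?up \<Theta>1')"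
    if b: "b \<in> \<Theta>0" for b
  proof -
    have b\<Theta>: "b \<in> \<Theta>" using b \<Theta> by auto
    have eq: "T -` (UNIV - D_low M p T \<Theta>0'') \<inter> space M = space M - ?low \<Theta>0''"
      "T -` (UNIV - D_up M p T \<Theta>1') \<inter> space M = space M - ?up \<Theta>1'"
      using low up by auto
    have "\<not> (AE x in M. x \<in> space M - ?low \<Theta>0'' \<longrightarrow> p b x = 0)"
      "\<not> (AE x in M. x \<in> space M - ?up \<Theta>1' \<longrightarrow> p b x = 0)"
      using assms(4) b measure_distr_eq_0[OF b\<Theta>, of "space M - ?low \<Theta>0''"]
        measure_distr_eq_0[OF b\<Theta>, of "space M - ?up \<Theta>1'"]
      unfolding pure_two_sided_def eq by auto
    moreover have "AE x in M. x \<in> space M - S \<longrightarrow> p b x = 0"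
      if "AE x in M. p b x \<noteq> 0 \<longrightarrow> x \<in> S" for S
      using that by eventually_elim auto
    ultimately show "\<not> (AE x in M. p b x \<noteq> 0 \<longrightarrow> x \<in> ?low \<Theta>0'')"
      "\<not> (AE x in M. p b x \<noteq> 0 \<longrightarrow> x \<in> ?up \<Theta>1')"
      by blast+
  qed
  have B: "B = space M - ?low \<Theta>0'' - ?up \<Theta>1'"
    unfolding assms(5) using low up by auto
  have B_sets: "B \<in> sets M" unfolding B by simp
  have overlap: "(\<forall>b\<in>\<Theta>0. AE x in M. p b x \<noteq> 0 \<longrightarrow> x \<in> ?low \<Theta>0'' \<union> ?up \<Theta>1') \<or>
      (\<exists>a\<in>\<Theta>1'. \<exists>b\<in>\<Theta>0. \<exists>c\<in>\<Theta>0''. \<not> (\<exists>Ba\<in>sets M. \<exists>Bc\<in>sets M. (AE x in M. x \<in> Ba \<union> Bc) \<and>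
        ratio_constant_on p b a Ba \<and> ratio_constant_on p c b Bc))"
  proof (cases "negligible_event M p \<Theta> B")
    case True
    have "AE x in M. p b x \<noteq> 0 \<longrightarrow> x \<in> ?low \<Theta>0'' \<union> ?up \<Theta>1'" if "b \<in> \<Theta>0" for b
    proof -
      have "AE x in M. p b x \<noteq> 0 \<longrightarrow> x \<notin> B"
        using True B_sets that \<Theta> by (auto simp: negligible_event_iff)
      with AE_space show ?thesis by eventually_elim (auto simp: B)
    qed
    then show ?thesis by blast
  next
    case False
    \<comment> \<open>A covering of the whole space up to an \<open>M\<close>-null set leaves a
      negligible part of \<open>B\<close> uncovered, so the hypothesis on almost sure coverings
      excludes it.\<close>
    have "negligible_event M p \<Theta> (B - (Ba \<union> Bc))"
      if "Ba \<in> sets M" "Bc \<in> sets M" "AE x in M. x \<in> Ba \<union> Bc" for Ba Bc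
      using that B_sets by (subst negligible_event_iff) (auto elim: eventually_mono)
    with False assms(6) show ?thesis by meson
  qed
  show ?thesis
  proof (intro set_eqI iffI; unfold mem_Collect_eq)
    fix \<phi> assume ex: "expert M p \<Theta>0 \<Theta>1 \<phi>"
    then have \<phi>: "decision_rule M \<phi>" unfolding expert_def by simp
    note ex' = ex[unfolded expert_iff[OF \<phi>]]
    \<comment> \<open>Condition (ii) is applied with \<open>A = D0\<close>, on which all densities
      of \<open>\<Theta>0\<close> vanish, and next with \<open>A = D1\<close>.\<close>
    have D0: "AE x in M. p t x \<noteq> 0 \<longrightarrow> x \<in> D0 \<longrightarrow> \<phi> x = 1" if "t \<in> \<Theta>1" for t
      using ex' D_sets(1) that D0_vanish by (auto 4 4 intro: AE_I2)
    have D1: "AE x in M. p b x \<noteq> 0 \<longrightarrow> x \<in> D1 \<longrightarrow> \<phi> x = 0" if "b \<in> \<Theta>0" for b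
      using ex' D_sets(2) that D1_vanish by (auto 4 4 intro: AE_I2)
    have "(\<forall>b\<in>\<Theta>0. AE x in M. p b x \<noteq> 0 \<longrightarrow> \<phi> x = 0) \<or>
        (\<forall>t\<in>\<Theta>1' \<union> \<Theta>0''. AE x in M. p t x \<noteq> 0 \<longrightarrow> \<phi> x = 1)"
      by (rule experts_trivial) (use \<Theta> ne lt ex' \<Theta>_eq pure overlap in auto)
    then have "(\<forall>\<theta>\<in>\<Theta>. AE x in M. p \<theta> x \<noteq> 0 \<longrightarrow> \<phi> x = indicator D0 x) \<or>
      (\<forall>\<theta>\<in>\<Theta>. AE x in M. p \<theta> x \<noteq> 0 \<longrightarrow> \<phi> x = 1 - indicator D1 x)"
    proof (elim disjE)
      assume z: "\<forall>b\<in>\<Theta>0. AE x in M. p b x \<noteq> 0 \<longrightarrow> \<phi> x = 0"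
      have "AE x in M. p \<theta> x \<noteq> 0 \<longrightarrow> \<phi> x = indicator D0 x" if "\<theta> \<in> \<Theta>0" for \<theta>
        using bspec[OF z that]
        by eventually_elim (use D0_vanish[OF that] in \<open>auto simp: indicator_def\<close>)
      moreover have "AE x in M. p \<theta> x \<noteq> 0 \<longrightarrow> \<phi> x = indicator D0 x" if "\<theta> \<in> \<Theta>1" for \<theta>
      proof -
        \<comment> \<open>The event \<open>\<phi> = 1\<close> is null for all of
          \<open>\<Theta>0\<close>, so \<open>in_D0\<close> gives the converse of
          \<open>D0\<close>.\<close>
        have "AE x in M. p \<theta> x \<noteq> 0 \<longrightarrow> \<phi> x = 1 \<longrightarrow> x \<in> D0"
          by (rule in_D0[OF _ that]) (use z in \<open>auto elim!: ballE eventually_mono\<close>)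
        with D0[OF that] AE_space show ?thesis
          by eventually_elim (use decision_rule_cases(2)[OF \<phi>] in \<open>auto simp: indicator_def\<close>)
      qed
      ultimately show ?thesis using \<Theta>_eq by blast
    next
      assume o: "\<forall>t\<in>\<Theta>1' \<union> \<Theta>0''. AE x in M. p t x \<noteq> 0 \<longrightarrow> \<phi> x = 1"
      have "AE x in M. p \<theta> x \<noteq> 0 \<longrightarrow> \<phi> x = 1 - indicator D1 x" if "\<theta> \<in> \<Theta>1" for \<theta>
      proof -
        have "AE x in M. p \<theta> x \<noteq> 0 \<longrightarrow> \<phi> x = 1" using o that \<Theta>_eq by blast
        then show ?thesis
          by eventually_elim (use D1_vanish[OF that] in \<open>auto simp: indicator_def\<close>)
      qed
      moreover have "AE x in M. p \<theta> x \<noteq> 0 \<longrightarrow> \<phi> x = 1 - indicator D1 x" if "\<theta> \<in> \<Theta>0" for \<theta>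
      proof -
        have "AE x in M. p \<theta> x \<noteq> 0 \<longrightarrow> \<phi> x = 0 \<longrightarrow> x \<in> D1"
          by (rule in_D1[OF _ that]) (use o \<Theta>_eq in \<open>auto elim!: ballE eventually_mono\<close>)
        with D1[OF that] AE_space show ?thesis
          by eventually_elim (use decision_rule_cases(2)[OF \<phi>] in \<open>auto simp: indicator_def\<close>)
      qed
      ultimately show ?thesis using \<Theta>_eq by blast
    qed
    with \<phi> show "decision_rule M \<phi> \<and>
      (almost_surely M p \<Theta> (\<lambda>x. \<phi> x = indicat_real (D_low M p T \<Theta>0 \<union> D_up M p T \<Theta>0) (T x)) \<or>
       almost_surely M p \<Theta> (\<lambda>x. \<phi> x = 1 - indicat_real (D_low M p T \<Theta>0'' \<inter> D_up M p T \<Theta>1') (T x)))"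
      unfolding as0 as1 by blast
  next
    fix \<phi> assume triv: "decision_rule M \<phi> \<and>
      (almost_surely M p \<Theta> (\<lambda>x. \<phi> x = indicat_real (D_low M p T \<Theta>0 \<union> D_up M p T \<Theta>0) (T x)) \<or>
       almost_surely M p \<Theta> (\<lambda>x. \<phi> x = 1 - indicat_real (D_low M p T \<Theta>0'' \<inter> D_up M p T \<Theta>1') (T x)))"
    then have \<phi>: "decision_rule M \<phi>" by simp
    from triv consider (zero) "\<forall>\<theta>\<in>\<Theta>. AE x in M. p \<theta> x \<noteq> 0 \<longrightarrow> \<phi> x = indicator D0 x"
      | (one) "\<forall>\<theta>\<in>\<Theta>. AE x in M. p \<theta> x \<noteq> 0 \<longrightarrow> \<phi> x = 1 - indicator D1 x"
      unfolding as0 as1 by blast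
    then show "expert M p \<Theta>0 \<Theta>1 \<phi>"
    proof cases
      \<comment> \<open>Since \<open>\<phi> = 0\<close> a.s. for \<open>\<Theta>0\<close>, condition
        (i) holds through its degenerate alternative and half of (ii) is immediate; the other half
        is \<open>in_D0\<close>.\<close>
      case zero
      have z: "AE x in M. p b x \<noteq> 0 \<longrightarrow> \<phi> x = 0" if "b \<in> \<Theta>0" for b
      proof -
        have "AE x in M. p b x \<noteq> 0 \<longrightarrow> \<phi> x = indicator D0 x" using zero that \<Theta> by blast
        then show ?thesis by eventually_elim (use D0_vanish[OF that] in \<open>auto simp: indicator_def\<close>)
      qed
      have "AE x in M. p t x \<noteq> 0 \<longrightarrow> x \<in> A \<longrightarrow> \<phi> x = 1"
        if A: "\<forall>b\<in>\<Theta>0. AE x in M. p b x \<noteq> 0 \<longrightarrow> x \<notin> A" and t: "t \<in> \<Theta>1" for A t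
      proof -
        have "AE x in M. p t x \<noteq> 0 \<longrightarrow> x \<in> A \<longrightarrow> x \<in> D0" using A by (intro in_D0[OF _ t]) auto
        moreover have "AE x in M. p t x \<noteq> 0 \<longrightarrow> \<phi> x = indicator D0 x" using zero t \<Theta> by blast
        ultimately show ?thesis by eventually_elim auto
      qed
      moreover have "AE x in M. p b x \<noteq> 0 \<longrightarrow> x \<in> A \<longrightarrow> \<phi> x = 0" if "b \<in> \<Theta>0" for A b
        using z[OF that] by eventually_elim auto
      ultimately show ?thesis
        unfolding expert_iff[OF \<phi>] separates_def using \<phi> z by blast
    next
      \<comment> \<open>Symmetrically, \<open>\<phi> = 1\<close> a.s. for \<open>\<Theta>1\<close>
        gives (i), and the remaining half of (ii) is \<open>in_D1\<close>.\<close>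
      case one
      have o: "AE x in M. p t x \<noteq> 0 \<longrightarrow> \<phi> x = 1" if "t \<in> \<Theta>1" for t
      proof -
        have "AE x in M. p t x \<noteq> 0 \<longrightarrow> \<phi> x = 1 - indicator D1 x" using one that \<Theta> by blast
        then show ?thesis by eventually_elim (use D1_vanish[OF that] in \<open>auto simp: indicator_def\<close>)
      qed
      have "AE x in M. p b x \<noteq> 0 \<longrightarrow> x \<in> A \<longrightarrow> \<phi> x = 0"
        if A: "\<forall>t\<in>\<Theta>1. AE x in M. p t x \<noteq> 0 \<longrightarrow> x \<notin> A" and b: "b \<in> \<Theta>0" for A b
      proof -
        have "AE x in M. p b x \<noteq> 0 \<longrightarrow> x \<in> A \<longrightarrow> x \<in> D1" using A by (intro in_D1[OF _ b]) auto
        moreover have "AE x in M. p b x \<noteq> 0 \<longrightarrow> \<phi> x = 1 - indicator D1 x" using one b \<Theta> by blast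
        ultimately show ?thesis by eventually_elim auto
      qed
      moreover have "AE x in M. p t x \<noteq> 0 \<longrightarrow> x \<in> A \<longrightarrow> \<phi> x = 1" if "t \<in> \<Theta>1" for A t
        using o[OF that] by eventually_elim auto
      ultimately show ?thesis
        unfolding expert_iff[OF \<phi>] separates_def using \<phi> o by blast
    qed
  qed
qed

end
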